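(* Let $f$ be a probability density on $\mathbb{R}$ with mean zero and variance one, and consider the location-scale family $$p(x;\theta)=\frac1\sigma f\!\left(\frac{x-\mu}{\sigma}\right),\qquad \theta=(\mu,\sigma),\ \mu\in\mathbb{R},\ \sigma>0.$$ Let $x_1,\dots,x_n$ be independent observations from $p(x;\theta)$, and let $\hat\theta_W=(\hat\mu_W,\hat\sigma_W)$ be the Wasserstein estimator $$\hat\mu_W=\bar x=\frac1n\sum_{t=1}^n x_t,\qquad \hat\sigma_W=\sqrt{\frac1n\sum_{t=1}^n(x_t-\bar x)^2}.$$ Then $\hat\theta_W$ asymptotically attains the Wasserstein--Cramer--Rao lower bound: for every $\theta$, $$n\left(\mathrm{Var}^{\mathrm W}_\theta(\hat\theta_W)-\frac1n\left(\frac{\partial}{\partial\theta}\mathrm{E}_\theta[\hat\theta_W]\right)^{\!\top}G_W(\theta)^{-1}\left(\frac{\partial}{\partial\theta}\mathrm{E}_\theta[\hat\theta_W]\right)\right)\longrightarrow\begin{pmatrix}0&0\\0&0\end{pmatrix}\qquad\text{as } n\to\infty,$$ where $G_W(\theta)$ is the $2\times2$ Wasserstein information matrix of the single-observation model $p(x;\theta)$.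
   Context: $\mathrm{E}_\theta$ denotes expectation under $p(\cdot;\theta)$, or under the product density $\prod_{t=1}^n p(x_t;\theta)$ for functions of $(x_1,\dots,x_n)$. Wasserstein score functions: for a parametric density $p(x;\theta)$ on $\mathbb{R}$ with $\theta=(\theta_1,\theta_2)$, $\Phi_i(x;\theta)$ ($i=1,2$) is the solution of $\frac{\partial}{\partial\theta_i}p(x;\theta)+\frac{\partial}{\partial x}\big(p(x;\theta)\frac{\partial}{\partial x}\Phi_i(x;\theta)\big)=0$ with $\mathrm{E}_\theta[\Phi_i(x;\theta)]=0$ (equation understood in the distributional sense where $f$ is not differentiable). For the location-scale family they are $\Phi_\mu(x;\theta)=x-\mu$ and $\Phi_\sigma(x;\theta)=\frac{(x-\mu)^2}{2\sigma}-\frac{\sigma}{2}$. Wasserstein information matrix (single observation): $G_W(\theta)_{ij}=\mathrm{E}_\theta\big[\frac{\partial\Phi_i}{\partial x}(x;\theta)\,\frac{\partial\Phi_j}{\partial x}(x;\theta)\big]$, $i,j\in\{1,2\}$, with $\theta_1=\mu$, $\theta_2=\sigma$. Wasserstein variance: for a statistic $b(x_1,\dots,x_n)\in\mathbb{R}^2$, $\mathrm{Var}^{\mathrm W}_\theta(b)$ is the $2\times2$ matrix with entries $\mathrm{E}_\theta\big[(\nabla b_i)^\top(\nabla b_j)\big]$, where $\nabla$ is the gradient with respect to $(x_1,\dots,x_n)\in\mathbb{R}^n$ (for $n\ge2$, $\hat\sigma_W$ is differentiable almost everywhere). $\frac{\partial}{\partial\theta}\mathrm{E}_\theta[b]$ is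 the $2\times2$ matrix with $(i,j)$ entry $\frac{\partial}{\partial\theta_i}\mathrm{E}_\theta[b_j]$. The Wasserstein estimator is in general defined as the zero of the Wasserstein scores, $\sum_t\Phi_\mu(x_t;\hat\theta_W)=\sum_t\Phi_\sigma(x_t;\hat\theta_W)=0$; for location-scale families this gives the formulas in the claim. *)

theory Defs
  imports "HOL-Analysis.Analysis"
begin

text \<open>
  A two-parameter model is a function \<open>p x \<theta>\<close> of the observation \<open>x\<close> and the parameter
  \<open>\<theta> :: real^2\<close>. A sample of size \<open>n\<close> is a function \<open>x :: nat \<Rightarrow> real\<close> of which only the
  coordinates \<open>x t\<close> with \<open>t < n\<close> matter.
\<close>

definition obs_measure :: "(real \<Rightarrow> real^2 \<Rightarrow> real) \<Rightarrow> real^2 \<Rightarrow> real measure" where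
  "obs_measure p \<theta> = density lborel (\<lambda>x. ennreal (p x \<theta>))"

definition sample_measure ::
    "(real \<Rightarrow> real^2 \<Rightarrow> real) \<Rightarrow> nat \<Rightarrow> real^2 \<Rightarrow> (nat \<Rightarrow> real) measure" where
  "sample_measure p n \<theta> =
     density (Pi\<^sub>M {..<n} (\<lambda>_. lborel)) (\<lambda>x. ennreal (\<Prod>t<n. p (x t) \<theta>))"

definition test_function :: "(real \<Rightarrow> real) \<Rightarrow> bool" where
  "test_function \<phi> \<longleftrightarrow>
     (\<forall>k x. (deriv ^^ k) \<phi> differentiable (at x)) \<and> compact (closure {x. \<phi> x \<noteq> 0})"

text \<open>
  \<open>wasserstein_score p i \<theta> \<Phi>\<close>: the function \<open>\<Phi>\<close> solves
  \<open>\<partial>p/\<partial>\<theta>\<^sub>i + \<partial>/\<partial>x (p \<partial>\<Phi>/\<partial>x) = 0\<close> at the parameter \<open>\<theta>\<close> and has mean zero. The equation is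
  read in the sense of distributions in \<open>x\<close>: tested against \<open>\<phi>\<close>, and with the \<open>x\<close>-derivative
  moved to \<open>\<phi>\<close>, it says \<open>\<partial>/\<partial>\<theta>\<^sub>i \<integral> p \<phi> dx = \<integral> p \<Phi>' \<phi>' dx\<close>. Square integrability of \<open>\<Phi>'\<close>
  makes the information matrix finite and replaces a boundary condition at infinity: without it,
  \<open>p \<Phi>'\<close> would be determined only up to an additive constant.
\<close>

definition wasserstein_score ::
    "(real \<Rightarrow> real^2 \<Rightarrow> real) \<Rightarrow> 2 \<Rightarrow> real^2 \<Rightarrow> (real \<Rightarrow> real) \<Rightarrow> bool" where
  "wasserstein_score p i \<theta> \<Phi> \<longleftrightarrow>
     (\<forall>x. \<Phi> differentiable (at x)) \<and>
     integrable (obs_measure p \<theta>) (\<lambda>x. (deriv \<Phi> x)\<^sup>2) \<and>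
     (\<forall>\<phi>. test_function \<phi> \<longrightarrow>
        ((\<lambda>s. LINT x|lborel. p x (\<theta> + s *\<^sub>R axis i 1) * \<phi> x) has_real_derivative
           (LINT x|lborel. p x \<theta> * deriv \<Phi> x * deriv \<phi> x)) (at 0)) \<and>
     has_bochner_integral (obs_measure p \<theta>) \<Phi> 0"

definition wasserstein_information ::
    "(real \<Rightarrow> real^2 \<Rightarrow> real) \<Rightarrow> (2 \<Rightarrow> real \<Rightarrow> real) \<Rightarrow> real^2 \<Rightarrow> real^2^2" where
  "wasserstein_information p \<Phi> \<theta> =
     (\<chi> i j. LINT x|obs_measure p \<theta>. deriv (\<Phi> i) x * deriv (\<Phi> j) x)"

definition sample_partial :: "nat \<Rightarrow> ((nat \<Rightarrow> real) \<Rightarrow> real) \<Rightarrow> (nat \<Rightarrow> real) \<Rightarrow> real" where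
  "sample_partial t g x = deriv (\<lambda>s. g (x(t := s))) (x t)"

definition wasserstein_variance ::
    "(real \<Rightarrow> real^2 \<Rightarrow> real) \<Rightarrow> nat \<Rightarrow> ((nat \<Rightarrow> real) \<Rightarrow> real^2) \<Rightarrow> real^2 \<Rightarrow> real^2^2" where
  "wasserstein_variance p n b \<theta> =
     (\<chi> i j. LINT x|sample_measure p n \<theta>.
        (\<Sum>t<n. sample_partial t (\<lambda>y. b y $ i) x * sample_partial t (\<lambda>y. b y $ j) x))"

definition expectation_jacobian ::
    "(real \<Rightarrow> real^2 \<Rightarrow> real) \<Rightarrow> nat \<Rightarrow> ((nat \<Rightarrow> real) \<Rightarrow> real^2) \<Rightarrow> real^2 \<Rightarrow> real^2^2" where
  "expectation_jacobian p n b \<theta> =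
     (\<chi> i j. deriv (\<lambda>s. LINT x|sample_measure p n (\<theta> + s *\<^sub>R axis i 1). b x $ j) 0)"

definition location_scale :: "(real \<Rightarrow> real) \<Rightarrow> real \<Rightarrow> real^2 \<Rightarrow> real" where
  "location_scale f x \<theta> = 1 / \<theta> $ 2 * f ((x - \<theta> $ 1) / \<theta> $ 2)"

definition sample_mean :: "nat \<Rightarrow> (nat \<Rightarrow> real) \<Rightarrow> real" where
  "sample_mean n x = 1 / real n * (\<Sum>t<n. x t)"

definition wasserstein_estimator :: "nat \<Rightarrow> (nat \<Rightarrow> real) \<Rightarrow> real^2" where
  "wasserstein_estimator n x =
     vector [sample_mean n x, sqrt (1 / real n * (\<Sum>t<n. (x t - sample_mean n x)\<^sup>2))]"

subsection \<open>The scores of a location-scale family\<close>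

lemma test_function_deriv:
  assumes "test_function \<phi>"
  shows "(\<phi> has_real_derivative deriv \<phi> x) (at x)"
    and "continuous_on UNIV (deriv \<phi>)"
    and "\<exists>B. \<forall>x. \<bar>\<phi> x\<bar> \<le> B \<and> \<bar>deriv \<phi> x\<bar> \<le> B"
proof -
  let ?K = "closure {x. \<phi> x \<noteq> 0}"
  have d0: "\<phi> differentiable (at x)" for x
    using assms unfolding test_function_def by (metis funpow_0)
  have d1: "deriv \<phi> differentiable (at x)" for x
    using assms unfolding test_function_def by (metis funpow_0 comp_apply funpow.simps(2))
  have K: "compact ?K" using assms by (simp add: test_function_def)
  show D: "(\<phi> has_real_derivative deriv \<phi> x) (at x)" for x
    using d0 by (simp add: DERIV_deriv_iff_real_differentiable)
  have c0: "continuous_on UNIV \<phi>"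
    using d0 by (simp add: continuous_on_eq_continuous_at differentiable_imp_continuous_within)
  show c1: "continuous_on UNIV (deriv \<phi>)"
    using d1 by (simp add: continuous_on_eq_continuous_at differentiable_imp_continuous_within)
  have out: "\<phi> x = 0 \<and> deriv \<phi> x = 0" if "x \<notin> ?K" for x
  proof -
    have z: "\<phi> y = 0" if "y \<in> - ?K" for y
      using that closure_subset[of "{x. \<phi> x \<noteq> 0}"] by blast
    have "(\<phi> has_real_derivative 0) (at x)"
    proof (rule has_field_derivative_transform_within_open)
      show "((\<lambda>_. 0) has_real_derivative 0) (at x)" by simp
      show "open (- ?K)" by (rule open_Compl) simp
      show "x \<in> - ?K" using that by simp
      show "0 = \<phi> y" if "y \<in> - ?K" for y using z[OF that] by simp
    qed
    then have "deriv \<phi> x = 0" by (rule DERIV_imp_deriv)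
    moreover have "\<phi> x = 0" by (rule z) (use that in simp)
    ultimately show ?thesis by simp
  qed
  have "bounded (\<phi> ` ?K)" "bounded (deriv \<phi> ` ?K)"
    by (intro compact_imp_bounded compact_continuous_image K continuous_on_subset[OF c0]
        continuous_on_subset[OF c1] subset_UNIV)+
  then obtain B1 B2 where B: "\<forall>x\<in>?K. \<bar>\<phi> x\<bar> \<le> B1" "\<forall>x\<in>?K. \<bar>deriv \<phi> x\<bar> \<le> B2"
    unfolding bounded_iff ball_simps real_norm_def by blast
  have "\<bar>\<phi> x\<bar> \<le> max 0 (max B1 B2) \<and> \<bar>deriv \<phi> x\<bar> \<le> max 0 (max B1 B2)" for x
  proof (cases "x \<in> ?K")
    case True
    then have "\<bar>\<phi> x\<bar> \<le> B1" "\<bar>deriv \<phi> x\<bar> \<le> B2" using B by blast+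
    then show ?thesis by linarith
  next
    case False
    then show ?thesis using out[OF False] by simp
  qed
  then show "\<exists>B. \<forall>x. \<bar>\<phi> x\<bar> \<le> B \<and> \<bar>deriv \<phi> x\<bar> \<le> B" by blast
qed

lemma deriv_under_integral:
  fixes f \<phi> :: "real \<Rightarrow> real"
  assumes f [measurable]: "f \<in> borel_measurable borel"
    and f0: "integrable lborel f" and f1: "integrable lborel (\<lambda>z. z * f z)"
    and \<phi>: "test_function \<phi>"
  shows "((\<lambda>s. LINT z|lborel. f z * \<phi> (m + c * z + s * (a + b * z))) has_real_derivative
          (LINT z|lborel. f z * (deriv \<phi> (m + c * z) * (a + b * z)))) (at 0)"
proof -
  note D = test_function_deriv(1)[OF \<phi>]
  obtain B where B: "\<And>x. \<bar>\<phi> x\<bar> \<le> B" "\<And>x. \<bar>deriv \<phi> x\<bar> \<le> B"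
    using test_function_deriv(3)[OF \<phi>] by blast
  have [measurable]: "deriv \<phi> \<in> borel_measurable borel"
    using test_function_deriv(2)[OF \<phi>] by (rule borel_measurable_continuous_onI)
  have [measurable]: "\<phi> \<in> borel_measurable borel"
    using D by (intro borel_measurable_continuous_onI) (blast intro: DERIV_isCont continuous_at_imp_continuous_on)
  let ?h = "\<lambda>s z. f z * \<phi> (m + c * z + s * (a + b * z))"
  let ?q = "\<lambda>s z. f z * ((\<phi> (m + c * z + s * (a + b * z)) - \<phi> (m + c * z)) / s)"
  let ?w = "\<lambda>z. B * (\<bar>a\<bar> * \<bar>f z\<bar> + \<bar>b\<bar> * \<bar>z * f z\<bar>)"
  have int: "integrable lborel (?h s)" for s
  proof (rule Bochner_Integration.integrable_bound[where f = "\<lambda>z. B * f z"])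
    show "AE z in lborel. norm (?h s z) \<le> norm (B * f z)"
    proof (rule AE_I2)
      fix z
      let ?y = "m + c * z + s * (a + b * z)"
      have "\<bar>\<phi> ?y\<bar> \<le> \<bar>B\<bar>" using B(1)[of ?y] by linarith
      then have "\<bar>\<phi> ?y\<bar> * \<bar>f z\<bar> \<le> \<bar>B\<bar> * \<bar>f z\<bar>" by (rule mult_right_mono) simp
      then show "norm (?h s z) \<le> norm (B * f z)" by (simp only: real_norm_def abs_mult mult.commute)
    qed
  qed (use f0 in auto)
  have w: "integrable lborel ?w" using f0 f1 by auto
  have lip: "\<bar>\<phi> y - \<phi> x\<bar> \<le> B * \<bar>y - x\<bar>" for x y
    using field_differentiable_bound[of UNIV \<phi> "deriv \<phi>" B y x] D B(2)
    by (simp add: has_field_derivative_at_within)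
  have lim: "(\<lambda>n. LINT z|lborel. ?q (X n) z) \<longlonglongrightarrow>
      (LINT z|lborel. f z * (deriv \<phi> (m + c * z) * (a + b * z)))"
    if X: "\<And>n. X n \<noteq> 0" "X \<longlonglongrightarrow> 0" for X :: "nat \<Rightarrow> real"
  proof (rule integral_dominated_convergence[where w = ?w])
    show "AE z in lborel. (\<lambda>n. ?q (X n) z) \<longlonglongrightarrow> f z * (deriv \<phi> (m + c * z) * (a + b * z))"
    proof (rule AE_I2)
      fix z
      have "((\<lambda>s. \<phi> (m + c * z + s * (a + b * z))) has_real_derivative
              deriv \<phi> (m + c * z) * (a + b * z)) (at 0)"
        by (rule DERIV_chain2[where f = \<phi>]) (use D[of "m + c * z"] in \<open>auto intro!: derivative_eq_intros\<close>)
      then have "((\<lambda>s. (\<phi> (m + c * z + s * (a + b * z)) - \<phi> (m + c * z)) / s) \<longlongrightarrow>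
          deriv \<phi> (m + c * z) * (a + b * z)) (at 0)"
        by (simp add: has_field_derivative_iff)
      then have "(\<lambda>n. (\<phi> (m + c * z + X n * (a + b * z)) - \<phi> (m + c * z)) / X n) \<longlonglongrightarrow>
          deriv \<phi> (m + c * z) * (a + b * z)"
        using X by (auto simp: tendsto_at_iff_sequentially comp_def)
      then show "(\<lambda>n. ?q (X n) z) \<longlonglongrightarrow> f z * (deriv \<phi> (m + c * z) * (a + b * z))"
        by (rule tendsto_mult_left)
    qed
    show "AE z in lborel. norm (?q (X n) z) \<le> ?w z" for n
    proof (rule AE_I2)
      fix z
      have B0: "0 \<le> B" using B(1)[of 0] by linarith
      have "\<bar>\<phi> (m + c * z + X n * (a + b * z)) - \<phi> (m + c * z)\<bar> \<le> B * \<bar>X n * (a + b * z)\<bar>"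
        using lip[of "m + c * z + X n * (a + b * z)" "m + c * z"] by simp
      then have "\<bar>(\<phi> (m + c * z + X n * (a + b * z)) - \<phi> (m + c * z)) / X n\<bar> \<le> B * \<bar>a + b * z\<bar>"
        using X(1)[of n] by (simp add: abs_divide abs_mult pos_divide_le_eq mult_ac)
      also have "\<dots> \<le> B * (\<bar>a\<bar> + \<bar>b\<bar> * \<bar>z\<bar>)"
        using B0 by (intro mult_left_mono) (auto simp: abs_mult[symmetric])
      finally have "\<bar>f z\<bar> * \<bar>(\<phi> (m + c * z + X n * (a + b * z)) - \<phi> (m + c * z)) / X n\<bar>
          \<le> \<bar>f z\<bar> * (B * (\<bar>a\<bar> + \<bar>b\<bar> * \<bar>z\<bar>))"
        by (rule mult_left_mono) simp
      also have "\<dots> = ?w z" by (simp add: abs_mult algebra_simps)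
      finally show "norm (?q (X n) z) \<le> ?w z" by (simp only: real_norm_def abs_mult)
    qed
  qed (use w in auto)
  have eq: "((LINT z|lborel. ?h s z) - (LINT z|lborel. ?h 0 z)) / s = (LINT z|lborel. ?q s z)" for s
  proof -
    have "(LINT z|lborel. ?q s z) = (LINT z|lborel. (?h s z - ?h 0 z) / s)"
      by (intro Bochner_Integration.integral_cong) (auto simp: algebra_simps diff_divide_distrib)
    also have "\<dots> = ((LINT z|lborel. ?h s z) - (LINT z|lborel. ?h 0 z)) / s"
      using int[of s] int[of 0] by (simp add: Bochner_Integration.integral_diff)
    finally show ?thesis by (rule sym)
  qed
  have "((\<lambda>s. ((LINT z|lborel. ?h s z) - (LINT z|lborel. ?h 0 z)) / s) \<longlongrightarrow>
      (LINT z|lborel. f z * (deriv \<phi> (m + c * z) * (a + b * z)))) (at 0)"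
    unfolding eq tendsto_at_iff_sequentially comp_def using lim by auto
  then show ?thesis by (simp add: has_field_derivative_iff)
qed

lemma location_scale_integral:
  assumes "\<theta> $ 2 > 0"
  shows "(LINT x|lborel. location_scale f x \<theta> * g x) = (LINT z|lborel. f z * g (\<theta> $ 1 + \<theta> $ 2 * z))"
  using assms
  by (subst lborel_integral_real_affine[where c = "\<theta> $ 2" and t = "\<theta> $ 1"])
     (simp_all add: location_scale_def)

lemma location_scale_has_expectation:
  fixes g :: "real \<Rightarrow> real"
  assumes [measurable]: "f \<in> borel_measurable borel" "g \<in> borel_measurable borel"
    and f0: "\<And>x. 0 \<le> f x" and s: "\<theta> $ 2 > 0"
    and I: "has_bochner_integral lborel (\<lambda>z. f z * g (\<theta> $ 1 + \<theta> $ 2 * z)) I"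
  shows "has_bochner_integral (obs_measure (location_scale f) \<theta>) g I"
proof -
  have [measurable]: "(\<lambda>x. location_scale f x \<theta>) \<in> borel_measurable borel"
    unfolding location_scale_def by measurable
  have nn: "0 \<le> location_scale f x \<theta>" for x using f0 s by (simp add: location_scale_def)
  have "integrable lborel (\<lambda>z. f z * g (\<theta> $ 1 + \<theta> $ 2 * z))"
    using I by (simp add: has_bochner_integral_iff)
  then have "integrable lborel (\<lambda>z. location_scale f (\<theta> $ 1 + \<theta> $ 2 * z) \<theta> * g (\<theta> $ 1 + \<theta> $ 2 * z))"
    using s by (simp add: location_scale_def)
  then have "integrable lborel (\<lambda>x. location_scale f x \<theta> * g x)"
    using s lborel_integrable_real_affine_iff[of "\<theta> $ 2" "\<lambda>x. location_scale f x \<theta> * g x" "\<theta> $ 1"]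
    by simp
  then have "has_bochner_integral lborel (\<lambda>x. location_scale f x \<theta> *\<^sub>R g x) I"
    using I location_scale_integral[OF s] by (simp add: has_bochner_integral_iff)
  then show ?thesis
    unfolding obs_measure_def by (intro has_bochner_integral_density) (auto simp: nn)
qed

text \<open>
  Wasserstein scores of a location-scale family exist, with the expected closed form, for every
  standardized density.
\<close>

lemma wasserstein_score_location_scale:
  fixes f :: "real \<Rightarrow> real"
  assumes f [measurable]: "f \<in> borel_measurable borel"
    and nonneg: "\<And>x. 0 \<le> f x"
    and total: "has_bochner_integral lborel f 1"
    and mean: "has_bochner_integral lborel (\<lambda>x. x * f x) 0"
    and var: "has_bochner_integral lborel (\<lambda>x. x\<^sup>2 * f x) 1"
    and s: "\<theta> $ 2 > 0"
  shows "wasserstein_score (location_scale f) 1 \<theta> (\<lambda>x. x - \<theta> $ 1)"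
    and "wasserstein_score (location_scale f) 2 \<theta> (\<lambda>x. (x - \<theta> $ 1)\<^sup>2 / (2 * \<theta> $ 2) - \<theta> $ 2 / 2)"
proof -
  let ?m = "\<theta> $ 1" and ?s = "\<theta> $ 2"
  have i0: "integrable lborel f" and i1: "integrable lborel (\<lambda>z. z * f z)"
    using total mean by (auto simp: has_bochner_integral_iff)
  have d1: "((\<lambda>x. x - ?m) has_real_derivative 1) (at x)" for x
    by (auto intro!: derivative_eq_intros)
  have d2: "((\<lambda>x. (x - ?m)\<^sup>2 / (2 * ?s) - ?s / 2) has_real_derivative (x - ?m) / ?s) (at x)" for x
    using s by (auto intro!: derivative_eq_intros simp: field_simps)
  have D1: "deriv (\<lambda>x. x - ?m) = (\<lambda>x. 1)" using d1 by (auto intro!: DERIV_imp_deriv)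
  have D2: "deriv (\<lambda>x. (x - ?m)\<^sup>2 / (2 * ?s) - ?s / 2) = (\<lambda>x. (x - ?m) / ?s)"
    using d2 by (auto intro!: DERIV_imp_deriv)
  note ex = location_scale_has_expectation[OF f _ nonneg s]
  have pde: "((\<lambda>h. LINT x|lborel. location_scale f x (\<theta> + h *\<^sub>R axis i 1) * \<phi> x) has_real_derivative
      (LINT x|lborel. location_scale f x \<theta> * (deriv \<phi> x * (a + b * ((x - ?m) / ?s))))) (at 0)"
    if \<phi>: "test_function \<phi>" and ab: "a = axis i 1 $ (1::2)" "b = axis i 1 $ (2::2)" for \<phi> i a b
  proof -
    have pos: "eventually (\<lambda>h. ?s + h * b > 0) (nhds 0)"
      by (rule order_tendstoD(1)[where y = ?s]) (use s in \<open>auto intro!: tendsto_eq_intros filterlim_ident\<close>)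
    have eq: "(LINT x|lborel. location_scale f x (\<theta> + h *\<^sub>R axis i 1) * \<phi> x) =
        (LINT z|lborel. f z * \<phi> (?m + ?s * z + h * (a + b * z)))" if "?s + h * b > 0" for h
      using that ab by (subst location_scale_integral) (auto simp: algebra_simps)
    have ev: "eventually (\<lambda>h. (LINT x|lborel. location_scale f x (\<theta> + h *\<^sub>R axis i 1) * \<phi> x) =
        (LINT z|lborel. f z * \<phi> (?m + ?s * z + h * (a + b * z)))) (nhds 0)"
      by (rule eventually_mono[OF pos eq])
    have "(LINT x|lborel. location_scale f x \<theta> * (deriv \<phi> x * (a + b * ((x - ?m) / ?s)))) =
        (LINT z|lborel. f z * (deriv \<phi> (?m + ?s * z) * (a + b * z)))"
      using s by (subst location_scale_integral) auto
    then show ?thesis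
      using deriv_under_integral[OF f i0 i1 \<phi>, of ?m ?s a b] DERIV_cong_ev[OF refl ev refl] by simp
  qed
  show "wasserstein_score (location_scale f) 1 \<theta> (\<lambda>x. x - ?m)"
    unfolding wasserstein_score_def D1
  proof (intro conjI allI impI)
    show "(\<lambda>x. x - ?m) differentiable (at x)" for x
      using d1 real_differentiable_def by blast
    show "integrable (obs_measure (location_scale f) \<theta>) (\<lambda>x. (1::real)\<^sup>2)"
      using ex[of "\<lambda>_. 1\<^sup>2" 1] total by (simp add: has_bochner_integral_iff)
    show "((\<lambda>h. LINT x|lborel. location_scale f x (\<theta> + h *\<^sub>R axis 1 1) * \<phi> x) has_real_derivative
      (LINT x|lborel. location_scale f x \<theta> * 1 * deriv \<phi> x)) (at 0)" if "test_function \<phi>" for \<phi>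
      using pde[OF that, of 1 1 0] by (simp add: axis_def)
    show "has_bochner_integral (obs_measure (location_scale f) \<theta>) (\<lambda>x. x - ?m) 0"
      using has_bochner_integral_mult_right[OF mean, of ?s] by (intro ex) (auto simp: mult_ac)
  qed
  show "wasserstein_score (location_scale f) 2 \<theta> (\<lambda>x. (x - ?m)\<^sup>2 / (2 * ?s) - ?s / 2)"
    unfolding wasserstein_score_def D2
  proof (intro conjI allI impI)
    show "(\<lambda>x. (x - ?m)\<^sup>2 / (2 * ?s) - ?s / 2) differentiable (at x)" for x
      using d2 real_differentiable_def by blast
    show "integrable (obs_measure (location_scale f) \<theta>) (\<lambda>x. ((x - ?m) / ?s)\<^sup>2)"
      using ex[of "\<lambda>x. ((x - ?m) / ?s)\<^sup>2" 1] var s by (simp add: has_bochner_integral_iff mult.commute)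
    show "((\<lambda>h. LINT x|lborel. location_scale f x (\<theta> + h *\<^sub>R axis 2 1) * \<phi> x) has_real_derivative
      (LINT x|lborel. location_scale f x \<theta> * ((x - ?m) / ?s) * deriv \<phi> x)) (at 0)"
      if "test_function \<phi>" for \<phi>
      using pde[OF that, of 0 2 1] by (simp add: axis_def mult_ac)
    have "has_bochner_integral lborel (\<lambda>z. ?s / 2 * (z\<^sup>2 * f z) - ?s / 2 * f z) (?s / 2 * 1 - ?s / 2 * 1)"
      by (intro has_bochner_integral_diff has_bochner_integral_mult_right var total)
    also have "(\<lambda>z. ?s / 2 * (z\<^sup>2 * f z) - ?s / 2 * f z) =
        (\<lambda>z. f z * ((?m + ?s * z - ?m)\<^sup>2 / (2 * ?s) - ?s / 2))"
      using s by (auto simp: field_simps power2_eq_square)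
    finally show "has_bochner_integral (obs_measure (location_scale f) \<theta>)
        (\<lambda>x. (x - ?m)\<^sup>2 / (2 * ?s) - ?s / 2) 0"
      by (intro ex) auto
  qed
qed

end

theory Submission
  imports Defs "HOL-Probability.Probability"
begin

text \<open>
  The variance and the information matrix can be computed exactly. The gradient of the sample mean is
  \<open>(1/n, \<dots>, 1/n)\<close> and that of the sample standard deviation \<open>S\<close> is the vector of the
  \<open>(x\<^sub>t - mean) / (n S)\<close>, so the Wasserstein variance is \<open>1/n\<close> times the identity. Two scores
  \<open>\<Phi>\<close> and \<open>\<Psi>\<close> for the same parameter give an integrable \<open>p (\<Phi>' - \<Psi>')\<close> with zero weak derivative,
  which therefore vanishes; hence the information matrix can be computed from the explicit scores, and
  it is the identity. By equivariance the Jacobian of the expectation is diagonal with entries \<open>1\<close> and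
  \<open>c\<^sub>n\<close>, where \<open>c\<^sub>n\<close> is the expectation of \<open>S\<close> for the standardized density. So the claim reduces to
  \<open>c\<^sub>n\<close> tending to \<open>1\<close>.
\<close>

subsection \<open>Uniqueness of weak solutions\<close>

text \<open>The classical smooth function \<open>exp (- 1 / x)\<close> extended by 0, here divided
  by powers of \<open>x\<close> because such quotients are what its derivatives are made of.\<close>

definition flat_exp :: "nat \<Rightarrow> real \<Rightarrow> real" where
  "flat_exp i x = (if x > 0 then exp (- 1 / x) / x ^ i else 0)"

text \<open>The substitution \<open>t = 1 / x\<close> turns the limit from the right into the decay
  of \<open>t ^ i / exp t\<close> at infinity.\<close>

lemma flat_exp_tendsto_0: "(flat_exp i \<longlongrightarrow> 0) (at 0)"
proof -
  have "((\<lambda>t::real. t ^ i / exp t) \<longlongrightarrow> 0) at_top"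
    by (rule tendsto_power_div_exp_0)
  then have "((\<lambda>x::real. inverse x ^ i / exp (inverse x)) \<longlongrightarrow> 0) (at_right 0)"
    by (rule filterlim_compose[OF _ filterlim_inverse_at_top_right])
  then have "(flat_exp i \<longlongrightarrow> 0) (at_right 0)"
    by (rule Lim_transform_eventually)
       (auto simp: eventually_at_filter flat_exp_def exp_minus field_simps intro!: always_eventually)
  moreover have "(flat_exp i \<longlongrightarrow> 0) (at_left 0)"
    by (rule tendsto_eventually) (auto simp: eventually_at_filter flat_exp_def)
  ultimately show ?thesis by (simp add: filterlim_at_split)
qed

text \<open>Away from 0 this is calculus; at 0 the difference quotient of \<open>flat_exp i\<close>
  is \<open>flat_exp (i + 1)\<close>, which tends to 0. The derivative is a combination of members
  of the same family, so differentiation can be iterated.\<close>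

lemma flat_exp_has_derivative:
  "(flat_exp i has_real_derivative flat_exp (i + 2) x - real i * flat_exp (i + 1) x) (at x)"
proof -
  consider "x > 0" | "x < 0" | "x = 0" by linarith
  then show ?thesis
  proof cases
    case 1
    have "((\<lambda>x. exp (- 1 / x) / x ^ i) has_real_derivative
        flat_exp (i + 2) x - real i * flat_exp (i + 1) x) (at x)"
    proof (cases i)
      case 0
      then show ?thesis
        using 1 by (auto intro!: derivative_eq_intros simp: flat_exp_def field_simps power2_eq_square)
    next
      case (Suc j)
      \<comment> \<open>Differentiating \<open>x ^ j\<close> leaves the exponent
        \<open>j - Suc 0\<close>; truncated subtraction makes \<open>j = 0\<close> an
        exception.\<close>
      have "j = 0 \<or> x ^ j = x * x ^ (j - Suc 0)"
        by (cases j) auto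
      then show ?thesis
        using 1 Suc by (auto intro!: derivative_eq_intros simp: flat_exp_def field_simps power2_eq_square)
    qed
    then show ?thesis
      by (rule has_field_derivative_transform_within_open[where S = "{0<..}"])
         (use 1 in \<open>auto simp: flat_exp_def\<close>)
  next
    case 2
    have "((\<lambda>_. 0) has_real_derivative flat_exp (i + 2) x - real i * flat_exp (i + 1) x) (at x)"
      using 2 by (simp add: flat_exp_def)
    then show ?thesis
      by (rule has_field_derivative_transform_within_open[where S = "{..<0}"])
         (use 2 in \<open>auto simp: flat_exp_def\<close>)
  next
    case 3
    have "flat_exp i y / y = flat_exp (i + 1) y" for y
      by (simp add: flat_exp_def)
    then show ?thesis
      using flat_exp_tendsto_0[of "i + 1"] 3
      by (simp add: has_field_derivative_iff flat_exp_def[of _ 0])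
  qed
qed

text \<open>A class of functions closed under differentiation, so that its members are smooth.\<close>

inductive_set flat_exp_algebra :: "(real \<Rightarrow> real) set" where
  affine: "(\<lambda>x. flat_exp i (a * x + b)) \<in> flat_exp_algebra"
| scale: "f \<in> flat_exp_algebra \<Longrightarrow> (\<lambda>x. c * f x) \<in> flat_exp_algebra"
| add: "f \<in> flat_exp_algebra \<Longrightarrow> g \<in> flat_exp_algebra \<Longrightarrow> (\<lambda>x. f x + g x) \<in> flat_exp_algebra"
| mult: "f \<in> flat_exp_algebra \<Longrightarrow> g \<in> flat_exp_algebra \<Longrightarrow> (\<lambda>x. f x * g x) \<in> flat_exp_algebra"

text \<open>Induction over the generation of the class: the chain rule for \<open>affine\<close>,
  linearity and the product rule for the rest.\<close>

lemma flat_exp_algebra_has_derivative: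
  assumes "f \<in> flat_exp_algebra"
  shows "\<exists>f'\<in>flat_exp_algebra. \<forall>x. (f has_real_derivative f' x) (at x)"
  using assms
proof induction
  case (affine i a b)
  let ?g = "\<lambda>x. a * flat_exp (i + 2) (a * x + b) + (- a * real i) * flat_exp (i + 1) (a * x + b)"
  have "?g \<in> flat_exp_algebra"
    by (intro flat_exp_algebra.intros)
  moreover have "((\<lambda>x. flat_exp i (a * x + b)) has_real_derivative ?g x) (at x)" for x
  proof -
    have "((\<lambda>x. flat_exp i (a * x + b)) has_real_derivative
        (flat_exp (i + 2) (a * x + b) - real i * flat_exp (i + 1) (a * x + b)) * a) (at x)"
      by (rule DERIV_chain2[OF flat_exp_has_derivative]) (auto intro!: derivative_eq_intros)
    then show ?thesis by (simp add: algebra_simps)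
  qed
  ultimately show ?case by (intro bexI[of _ ?g]) auto
next
  case (scale f c)
  then obtain f' where "f' \<in> flat_exp_algebra" "\<And>x. (f has_real_derivative f' x) (at x)" by blast
  then show ?case
    by (intro bexI[of _ "\<lambda>x. c * f' x"]) (auto intro: flat_exp_algebra.intros DERIV_cmult)
next
  case (add f g)
  then obtain f' g' where "f' \<in> flat_exp_algebra" "\<And>x. (f has_real_derivative f' x) (at x)"
    "g' \<in> flat_exp_algebra" "\<And>x. (g has_real_derivative g' x) (at x)" by blast
  then show ?case
    by (intro bexI[of _ "\<lambda>x. f' x + g' x"]) (auto intro: flat_exp_algebra.intros DERIV_add)
next
  case (mult f g)
  then obtain f' g' where "f' \<in> flat_exp_algebra" "\<And>x. (f has_real_derivative f' x) (at x)"
    "g' \<in> flat_exp_algebra" "\<And>x. (g has_real_derivative g' x) (at x)" by blast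
  then show ?case using mult.hyps
    by (intro bexI[of _ "\<lambda>x. f' x * g x + g' x * f x"])
       (auto intro!: flat_exp_algebra.intros intro: DERIV_mult)
qed

lemma flat_exp_algebra_smooth:
  assumes "f \<in> flat_exp_algebra"
  shows "(deriv ^^ k) f differentiable (at x)"
proof -
  have "deriv g \<in> flat_exp_algebra" if g: "g \<in> flat_exp_algebra" for g
  proof -
    obtain g' where g': "g' \<in> flat_exp_algebra" "\<And>x. (g has_real_derivative g' x) (at x)"
      using flat_exp_algebra_has_derivative[OF g] by blast
    then have "deriv g = g'" by (auto intro: DERIV_imp_deriv)
    then show ?thesis using g' by simp
  qed
  then have "(deriv ^^ k) f \<in> flat_exp_algebra"
    using assms by (induction k) auto
  then show ?thesis
    using flat_exp_algebra_has_derivative real_differentiable_def by blast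
qed

text \<open>As \<open>k\<close> grows, these test functions converge to the indicator of \<open>{a<..}\<close>.\<close>

definition smooth_cutoff :: "real \<Rightarrow> real \<Rightarrow> real \<Rightarrow> real" where
  "smooth_cutoff k a x = flat_exp 0 (k * (x - a)) * flat_exp 0 (k * (a + k - x))"

text \<open>Both factors are \<open>flat_exp 0\<close> of an affine function, so smoothness comes
  from the algebra. One factor vanishes left of \<open>a\<close>, the other right of
  \<open>a + k\<close>, which confines the support.\<close>

lemma test_function_smooth_cutoff:
  assumes "k > 0"
  shows "test_function (smooth_cutoff k a)"
proof -
  have "(\<lambda>x. flat_exp 0 (k * x + (- k * a)) * flat_exp 0 ((- k) * x + k * (a + k))) \<in> flat_exp_algebra"
    by (intro flat_exp_algebra.intros)
  also have "(\<lambda>x. flat_exp 0 (k * x + (- k * a)) * flat_exp 0 ((- k) * x + k * (a + k))) = smooth_cutoff k a"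
    by (auto simp: smooth_cutoff_def algebra_simps)
  finally have "smooth_cutoff k a \<in> flat_exp_algebra" .
  moreover have "{x. smooth_cutoff k a x \<noteq> 0} \<subseteq> {a..a+k}"
    using assms by (auto simp: smooth_cutoff_def flat_exp_def zero_less_mult_iff split: if_splits)
  then have "compact (closure {x. smooth_cutoff k a x \<noteq> 0})"
    using bounded_subset[OF bounded_closed_interval] by (auto simp: compact_closure)
  ultimately show ?thesis
    unfolding test_function_def using flat_exp_algebra_smooth by blast
qed

lemma smooth_cutoff_bounds: "0 \<le> smooth_cutoff k a x" "smooth_cutoff k a x \<le> 1"
proof -
  have "0 \<le> flat_exp 0 y" "flat_exp 0 y \<le> 1" for y by (auto simp: flat_exp_def)
  then show "0 \<le> smooth_cutoff k a x" "smooth_cutoff k a x \<le> 1"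
    unfolding smooth_cutoff_def by (auto intro: mult_le_one)
qed

text \<open>Moving \<open>a\<close> amounts to translating the argument of one fixed test function,
  so the dependence on \<open>a\<close> can be differentiated under the integral.\<close>

lemma smooth_cutoff_shift: "smooth_cutoff k a x = smooth_cutoff k 0 (x - a)"
  by (simp add: smooth_cutoff_def algebra_simps)

lemma smooth_cutoff_measurable [measurable]: "smooth_cutoff k a \<in> borel_measurable borel"
  unfolding smooth_cutoff_def flat_exp_def by measurable

text \<open>For \<open>x > a\<close> the arguments of both factors tend to infinity, where
  \<open>flat_exp 0\<close> tends to 1; otherwise the first factor is 0 throughout.\<close>

lemma smooth_cutoff_tendsto_indicator:
  "(\<lambda>n. smooth_cutoff (real (Suc n)) a x) \<longlonglongrightarrow> indicator {a<..} x"
proof (cases "x > a")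
  case True
  have lim: "(flat_exp 0 \<longlongrightarrow> 1) at_top"
  proof (rule Lim_transform_eventually)
    show "((\<lambda>x::real. exp (- inverse x)) \<longlongrightarrow> 1) at_top"
      by (rule tendsto_eq_intros tendsto_inverse_0_at_top filterlim_ident | simp)+
    show "\<forall>\<^sub>F x in at_top. exp (- inverse x) = flat_exp 0 x"
      using eventually_gt_at_top[of 0] by eventually_elim (simp add: flat_exp_def inverse_eq_divide)
  qed
  have r: "filterlim (\<lambda>n. real (Suc n)) at_top sequentially"
    by (rule filterlim_compose[OF filterlim_real_sequentially filterlim_Suc])
  have "filterlim (\<lambda>n. real (Suc n) * (x - a)) at_top sequentially"
    using r by (rule filterlim_at_top_mult_tendsto_pos[OF tendsto_const, rotated]) (use True in auto)
  moreover have "filterlim (\<lambda>n. (a - x) + real (Suc n)) at_top sequentially"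
    by (rule filterlim_tendsto_add_at_top[OF tendsto_const r])
  then have "filterlim (\<lambda>n. real (Suc n) * ((a - x) + real (Suc n))) at_top sequentially"
    by (rule filterlim_at_top_mult_at_top[OF r])
  then have "filterlim (\<lambda>n. real (Suc n) * (a + real (Suc n) - x)) at_top sequentially"
    by (simp add: algebra_simps)
  ultimately have "(\<lambda>n. smooth_cutoff (real (Suc n)) a x) \<longlonglongrightarrow> 1 * 1"
    unfolding smooth_cutoff_def by (intro tendsto_mult filterlim_compose[OF lim])
  then show ?thesis using True by simp
next
  case False
  then have "smooth_cutoff (real (Suc n)) a x = 0" for n
    by (auto simp: smooth_cutoff_def flat_exp_def zero_less_mult_iff)
  then show ?thesis using False by simp
qed

text \<open>The positive and the negative part of \<open>h\<close> are densities of finite measures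
  that agree on half-lines, hence everywhere. So the two parts agree almost everywhere, and as one
  of them is always 0, both are.\<close>

lemma AE_zero_if_integrals_greaterThan_zero:
  fixes h :: "real \<Rightarrow> real"
  assumes h: "integrable lborel h"
    and zero: "\<And>a. (LINT x|lborel. h x * indicator {a<..} x) = 0"
  shows "AE x in lborel. h x = 0"
proof -
  have [measurable]: "h \<in> borel_measurable borel" using h by auto
  let ?P = "density lborel (\<lambda>x. ennreal (h x))" and ?N = "density lborel (\<lambda>x. ennreal (- h x))"
  \<comment> \<open>\<open>ennreal\<close> sends negative reals to 0, so \<open>density\<close> sees
    the positive part of \<open>g\<close> only.\<close>
  have em: "emeasure (density lborel (\<lambda>x. ennreal (g x))) {a<..} =
      ennreal (LINT x|lborel. max 0 (g x) * indicator {a<..} x)"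
    if g: "integrable lborel g" for g :: "real \<Rightarrow> real" and a
  proof -
    have [measurable]: "g \<in> borel_measurable borel" using g by auto
    have "emeasure (density lborel (\<lambda>x. ennreal (g x))) {a<..} =
        (\<integral>\<^sup>+x. ennreal (max 0 (g x) * indicator {a<..} x) \<partial>lborel)"
      by (subst emeasure_density)
         (auto intro!: nn_integral_cong simp: indicator_def max_def ennreal_neg)
    also have "\<dots> = ennreal (LINT x|lborel. max 0 (g x) * indicator {a<..} x)"
      by (intro nn_integral_eq_integral integrable_real_mult_indicator)
         (use g in \<open>auto intro!: Bochner_Integration.integrable_max\<close>)
    finally show ?thesis .
  qed
  have "?P = ?N"
  proof (rule measure_eqI_lessThan)
    fix a
    have "(LINT x|lborel. max 0 (h x) * indicator {a<..} x) - (LINT x|lborel. max 0 (- h x) * indicator {a<..} x)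
        = (LINT x|lborel. max 0 (h x) * indicator {a<..} x - max 0 (- h x) * indicator {a<..} x)"
      by (intro Bochner_Integration.integral_diff[symmetric] integrable_real_mult_indicator)
         (use h in \<open>auto intro!: Bochner_Integration.integrable_max\<close>)
    also have "\<dots> = (LINT x|lborel. h x * indicator {a<..} x)"
      by (intro Bochner_Integration.integral_cong) (auto simp: max_def indicator_def)
    finally show "emeasure ?P {a<..} = emeasure ?N {a<..}"
      using h zero by (simp add: em)
    show "emeasure ?P {a<..} < \<infinity>" using h by (simp add: em)
  qed auto
  then have "AE x in lborel. ennreal (h x) = ennreal (- h x)"
    by (intro sigma_finite_measure.density_unique[OF sigma_finite_lborel]) auto
  then show ?thesis
  proof eventually_elim
    case (elim x)
    then show ?case
      by (cases "h x \<ge> 0") (auto simp: ennreal_neg ennreal_eq_0_iff dest: sym)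
  qed
qed

text \<open>
  The integrals against a fixed test function translated by \<open>a\<close> have derivative zero in \<open>a\<close> and
  vanish as \<open>a\<close> tends to infinity; hence they are zero.
\<close>

lemma AE_zero_if_weak_derivative_zero:
  fixes h :: "real \<Rightarrow> real"
  assumes h: "integrable lborel h" and h1: "integrable lborel (\<lambda>x. x * h x)"
    and weak: "\<And>\<phi>. test_function \<phi> \<Longrightarrow> (LINT x|lborel. h x * deriv \<phi> x) = 0"
  shows "AE x in lborel. h x = 0"
proof (rule AE_zero_if_integrals_greaterThan_zero[OF h])
  have [measurable]: "h \<in> borel_measurable borel" using h by auto
  have bound: "norm (h x * smooth_cutoff k a x) \<le> \<bar>h x\<bar>" for k a x
    using smooth_cutoff_bounds[of k a x] by (simp add: abs_mult mult_left_le)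
  have zero: "(LINT x|lborel. h x * smooth_cutoff k a x) = 0" if k: "k > 0" for k a
  proof -
    let ?G = "\<lambda>a. LINT x|lborel. h x * smooth_cutoff k a x"
    have "(?G has_real_derivative 0) (at a)" for a
    proof -
      have d: "deriv (smooth_cutoff k a) x = deriv (smooth_cutoff k 0) (x - a)" for x
      proof (rule DERIV_imp_deriv)
        have "((\<lambda>x. smooth_cutoff k 0 (x - a)) has_real_derivative deriv (smooth_cutoff k 0) (x - a) * 1) (at x)"
          by (rule DERIV_chain2[OF test_function_deriv(1)[OF test_function_smooth_cutoff[OF k]]])
             (auto intro!: derivative_eq_intros)
        then show "(smooth_cutoff k a has_real_derivative deriv (smooth_cutoff k 0) (x - a)) (at x)"
          using smooth_cutoff_shift[of k a] by (metis (no_types, lifting) ext mult.right_neutral)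
      qed
      \<comment> \<open>The instance \<open>m = - a\<close>, \<open>c = 1\<close> with direction
        \<open>- 1\<close>: increasing \<open>s\<close> moves the cutoff from \<open>a\<close> to
        \<open>a + s\<close>.\<close>
      have "((\<lambda>s. LINT z|lborel. h z * smooth_cutoff k 0 (- a + 1 * z + s * (- 1 + 0 * z))) has_real_derivative
          (LINT z|lborel. h z * (deriv (smooth_cutoff k 0) (- a + 1 * z) * (- 1 + 0 * z)))) (at 0)"
        by (rule deriv_under_integral) (use h h1 test_function_smooth_cutoff[OF k] in auto)
      also have "(LINT z|lborel. h z * (deriv (smooth_cutoff k 0) (- a + 1 * z) * (- 1 + 0 * z))) = 0"
        using weak[OF test_function_smooth_cutoff[OF k, of a]] by (simp add: d)
      also have "(\<lambda>s. LINT z|lborel. h z * smooth_cutoff k 0 (- a + 1 * z + s * (- 1 + 0 * z))) = (\<lambda>s. ?G (a + s))"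
        by (simp add: smooth_cutoff_shift[of k "_ + _"] algebra_simps)
      finally show ?thesis
        using DERIV_shift[of ?G 0 0 a] by (simp add: add.commute)
    qed
    then have const: "?G b = ?G a" for b
      using DERIV_isconst_all by blast
    have "(\<lambda>n. ?G (real n)) \<longlonglongrightarrow> (LINT x::real|lborel. 0)"
    proof (rule integral_dominated_convergence[where w = "\<lambda>x. \<bar>h x\<bar>"])
      show "AE x in lborel. (\<lambda>n. h x * smooth_cutoff k (real n) x) \<longlonglongrightarrow> 0"
      proof (rule AE_I2)
        fix x
        have "\<forall>\<^sub>F n in sequentially. real n > x"
          using filterlim_real_sequentially by (simp add: filterlim_at_top_dense)
        then have "\<forall>\<^sub>F n in sequentially. h x * smooth_cutoff k (real n) x = 0"
          by eventually_elim (use k in \<open>auto simp: smooth_cutoff_def flat_exp_def zero_less_mult_iff\<close>)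
        then show "(\<lambda>n. h x * smooth_cutoff k (real n) x) \<longlonglongrightarrow> 0" by (rule tendsto_eventually)
      qed
    qed (use h bound in auto)
    moreover have "?G (real n) = ?G a" for n by (rule const)
    ultimately show ?thesis by (simp add: LIMSEQ_const_iff)
  qed
  fix a
  have "(\<lambda>n. LINT x|lborel. h x * smooth_cutoff (real (Suc n)) a x) \<longlonglongrightarrow>
      (LINT x|lborel. h x * indicator {a<..} x)"
    by (rule integral_dominated_convergence[where w = "\<lambda>x. \<bar>h x\<bar>"])
       (use h bound smooth_cutoff_tendsto_indicator in \<open>auto intro!: tendsto_mult\<close>)
  then show "(LINT x|lborel. h x * indicator {a<..} x) = 0"
    by (simp add: zero LIMSEQ_const_iff)
qed

text \<open>The derivative need not be continuous, but it is the pointwise limit of difference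
  quotients with steps \<open>1 / real (Suc n)\<close>.\<close>

lemma deriv_borel_measurable:
  fixes g :: "real \<Rightarrow> real"
  assumes "\<And>x. g differentiable (at x)"
  shows "deriv g \<in> borel_measurable borel"
proof (rule borel_measurable_LIMSEQ_real)
  have [measurable]: "g \<in> borel_measurable borel"
    using assms by (intro borel_measurable_continuous_onI)
      (simp add: continuous_on_eq_continuous_at differentiable_imp_continuous_within)
  show "(\<lambda>n. (g (x + 1 / real (Suc n)) - g x) / (1 / real (Suc n))) \<longlonglongrightarrow> deriv g x" for x
  proof -
    have "((\<lambda>s. (g (x + s) - g x) / s) \<longlongrightarrow> deriv g x) (at 0)"
      using assms[of x] by (simp add: DERIV_deriv_iff_real_differentiable[symmetric] DERIV_def)
    moreover have "filterlim (\<lambda>n. 1 / real (Suc n)) (at 0) sequentially"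
      unfolding filterlim_at using LIMSEQ_Suc[OF lim_1_over_n] by auto
    ultimately show ?thesis by (rule filterlim_compose)
  qed
  show "(\<lambda>x. (g (x + 1 / real (Suc n)) - g x) / (1 / real (Suc n))) \<in> borel_measurable borel" for n
    by measurable
qed

subsection \<open>The expected standard deviation of an i.i.d. sample\<close>

lemma iid_product_moment:
  fixes Q :: "real measure" and g :: "real \<Rightarrow> real" and n :: nat
  assumes Q: "prob_space Q"
    and g: "has_bochner_integral Q g m" and g2: "has_bochner_integral Q (\<lambda>z. (g z)\<^sup>2) v"
    and "s < n" "t < n"
  shows "has_bochner_integral (Pi\<^sub>M {..<n} (\<lambda>_. Q)) (\<lambda>x. g (x s) * g (x t)) (if s = t then v else m\<^sup>2)"
proof -
  interpret Q: prob_space Q by fact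
  interpret product_sigma_finite "\<lambda>_::nat. Q" by standard
  \<comment> \<open>Writes \<open>g (x s) * g (x t)\<close> as a product with one factor per
    coordinate, equal to 1 at the idle ones, so that the product formula for integrals applies. If
    \<open>s = t\<close>, both factors fall on one coordinate and give the square.\<close>
  define h where "h = (\<lambda>i z. (if i = s then g z else 1) * (if i = t then g z else 1))"
  have h: "has_bochner_integral Q (h i) (if i = s \<and> i = t then v else if i = s \<or> i = t then m else 1)" for i
    using g g2 by (auto simp: h_def power2_eq_square[symmetric] has_bochner_integral_iff Q.prob_space)
  have "(\<Prod>i<n. h i (x i)) = g (x s) * g (x t)" for x
    using assms(4,5) by (simp add: h_def prod.distrib)
  moreover have "(\<Prod>i<n. integral\<^sup>L Q (h i)) = (if s = t then v else m\<^sup>2)"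
  proof -
    have "(\<Prod>i<n. integral\<^sup>L Q (h i)) =
        (\<Prod>i<n. if i = s \<and> i = t then v else if i = s \<or> i = t then m else 1)"
      using h by (intro prod.cong) (auto simp: has_bochner_integral_iff)
    also have "\<dots> = (\<Prod>i\<in>{s, t}. if i = s \<and> i = t then v else if i = s \<or> i = t then m else 1)"
      using assms(4,5) by (intro prod.mono_neutral_right) auto
    also have "\<dots> = (if s = t then v else m\<^sup>2)" by (auto simp: power2_eq_square)
    finally show ?thesis .
  qed
  moreover have "integrable Q (h i)" for i using h by (auto simp: has_bochner_integral_iff)
  ultimately show ?thesis
    using product_integral_prod[of "{..<n}" h] product_integrable_prod[of "{..<n}" h]
    by (simp add: has_bochner_integral_iff)
qed

lemma iid_component_moment:
  fixes Q :: "real measure" and g :: "real \<Rightarrow> real" and n :: nat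
  assumes Q: "prob_space Q" and g: "has_bochner_integral Q g m" and t: "t < n"
  shows "has_bochner_integral (Pi\<^sub>M {..<n} (\<lambda>_. Q)) (\<lambda>x. g (x t)) m"
proof -
  have X: "(\<lambda>x. x t) \<in> Pi\<^sub>M {..<n} (\<lambda>_. Q) \<rightarrow>\<^sub>M Q" and [measurable]: "g \<in> borel_measurable Q"
    using t g by (auto simp: has_bochner_integral_iff)
  have "distr (Pi\<^sub>M {..<n} (\<lambda>_. Q)) Q (\<lambda>x. x t) = Q"
    using t Q by (intro distr_PiM_component) auto
  then show ?thesis
    using g integrable_distr_eq[OF X, of g] integral_distr[OF X, of g] by (simp add: has_bochner_integral_iff)
qed

text \<open>In the expanded square the diagonal terms have expectation \<open>v\<close> and all
  others \<open>m\<^sup>2\<close>; the excess over \<open>m\<^sup>2\<close> is the variance of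
  \<open>g\<close> divided by \<open>n\<close>.\<close>

lemma iid_mean_square:
  fixes Q :: "real measure" and g :: "real \<Rightarrow> real" and n :: nat
  assumes Q: "prob_space Q"
    and g: "has_bochner_integral Q g m" and g2: "has_bochner_integral Q (\<lambda>z. (g z)\<^sup>2) v"
    and n: "n > 0"
  shows "has_bochner_integral (Pi\<^sub>M {..<n} (\<lambda>_. Q)) (\<lambda>x. (1 / real n * (\<Sum>t<n. g (x t)))\<^sup>2)
           (m\<^sup>2 + (v - m\<^sup>2) / real n)"
proof -
  have "has_bochner_integral (Pi\<^sub>M {..<n} (\<lambda>_. Q))
      (\<lambda>x. (1 / real n)\<^sup>2 * (\<Sum>s<n. \<Sum>t<n. g (x s) * g (x t)))
      ((1 / real n)\<^sup>2 * (\<Sum>s<n. \<Sum>t<n. if s = t then v else m\<^sup>2))"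
    by (intro has_bochner_integral_mult_right has_bochner_integral_sum iid_product_moment[OF Q g g2]) auto
  also have "(\<lambda>x. (1 / real n)\<^sup>2 * (\<Sum>s<n. \<Sum>t<n. g (x s) * g (x t))) =
      (\<lambda>x. (1 / real n * (\<Sum>t<n. g (x t)))\<^sup>2)"
    by (simp add: fun_eq_iff power2_eq_square sum_product)
  also have "(\<Sum>s<n. \<Sum>t<n. if s = t then v else m\<^sup>2) = (\<Sum>s<n. \<Sum>t<n. m\<^sup>2 + (if s = t then v - m\<^sup>2 else 0))"
    by (intro sum.cong) auto
  also have "\<dots> = real n * (real n * m\<^sup>2 + (v - m\<^sup>2))"
    by (simp add: sum.distrib)
  also have "(1 / real n)\<^sup>2 * \<dots> = m\<^sup>2 + (v - m\<^sup>2) / real n"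
    using n by (simp add: field_simps power2_eq_square)
  finally show ?thesis .
qed

section \<open>Sample standard deviation: algebra, measurability, equivariance and bounds\<close>

definition sample_sd :: "nat \<Rightarrow> (nat \<Rightarrow> real) \<Rightarrow> real" where
  "sample_sd n x = sqrt (1 / real n * (\<Sum>t<n. (x t - sample_mean n x)\<^sup>2))"

lemma wasserstein_estimator_nth [simp]:
  "wasserstein_estimator n x $ 1 = sample_mean n x"
  "wasserstein_estimator n x $ 2 = sample_sd n x"
  by (simp_all add: wasserstein_estimator_def sample_sd_def)

lemma sample_sd_nonneg: "0 \<le> sample_sd n x"
  by (simp add: sample_sd_def sum_nonneg)

lemma sample_sd_square_eq_mean_sum: "(sample_sd n x)\<^sup>2 = 1 / real n * (\<Sum>t<n. (x t - sample_mean n x)\<^sup>2)"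
  by (simp add: sample_sd_def sum_nonneg)

lemma sample_sd_square:
  assumes "n > 0"
  shows "(sample_sd n x)\<^sup>2 = 1 / real n * (\<Sum>t<n. (x t)\<^sup>2) - (sample_mean n x)\<^sup>2"
proof -
  let ?m = "sample_mean n x"
  have s: "(\<Sum>t<n. x t) = real n * ?m" using assms by (simp add: sample_mean_def)
  have "(\<Sum>t<n. (x t - ?m)\<^sup>2) = (\<Sum>t<n. (x t)\<^sup>2) - 2 * ?m * (\<Sum>t<n. x t) + real n * ?m\<^sup>2"
    by (simp add: power2_diff sum.distrib sum_subtractf sum_distrib_left algebra_simps)
  then show ?thesis
    using assms unfolding s sample_sd_square_eq_mean_sum by (simp add: field_simps power2_eq_square)
qed

lemma sample_mean_measurable [measurable]:
  assumes "sets Q = sets borel"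
  shows "sample_mean n \<in> borel_measurable (Pi\<^sub>M {..<n} (\<lambda>_. Q))"
proof -
  have [measurable]: "(\<lambda>x. x t) \<in> borel_measurable (Pi\<^sub>M {..<n} (\<lambda>_. Q))" if "t < n" for t
    using measurable_component_singleton[of t "{..<n}" "\<lambda>_. Q"] that assms
    by (simp cong: measurable_cong_sets)
  show ?thesis
    unfolding sample_mean_def by measurable
qed

lemma sample_sd_measurable [measurable]:
  assumes "sets Q = sets borel"
  shows "sample_sd n \<in> borel_measurable (Pi\<^sub>M {..<n} (\<lambda>_. Q))"
proof -
  have [measurable]: "(\<lambda>x. x t) \<in> borel_measurable (Pi\<^sub>M {..<n} (\<lambda>_. Q))" if "t < n" for t
    using measurable_component_singleton[of t "{..<n}" "\<lambda>_. Q"] that assms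
    by (simp cong: measurable_cong_sets)
  note sample_mean_measurable[OF assms, measurable]
  show ?thesis
    unfolding sample_sd_def by measurable
qed

text \<open>The affine map is applied through \<open>compose {..<n}\<close> because the product of
  image measures is the image under that function.\<close>

lemma sample_mean_affine:
  assumes "n > 0"
  shows "sample_mean n (compose {..<n} (\<lambda>z. m + s * z) x) = m + s * sample_mean n x"
  using assms by (simp add: sample_mean_def compose_def sum.distrib sum_distrib_left[symmetric] field_simps)

lemma sample_sd_affine:
  assumes "n > 0" "s \<ge> 0"
  shows "sample_sd n (compose {..<n} (\<lambda>z. m + s * z) x) = s * sample_sd n x"
proof -
  have "(\<Sum>t<n. (compose {..<n} (\<lambda>z. m + s * z) x t - sample_mean n (compose {..<n} (\<lambda>z. m + s * z) x))\<^sup>2)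
      = (\<Sum>t<n. s\<^sup>2 * (x t - sample_mean n x)\<^sup>2)"
    unfolding sample_mean_affine[OF assms(1)]
    by (intro sum.cong) (auto simp: compose_def power_mult_distrib[symmetric] algebra_simps)
  then show ?thesis
    using assms by (simp add: sample_sd_def sum_distrib_left[symmetric] real_sqrt_mult real_sqrt_divide)
qed

text \<open>With \<open>q = sqrt (y / m)\<close> the gap, divided by \<open>sqrt m\<close>, is half
  of \<open>q * ((q - 1)\<^sup>2 * (q + 2))\<close>. The bound is a quadratic in \<open>y\<close>
  touching the root at \<open>y = m\<close>, so its expectation involves only two moments of
  \<open>y\<close>.\<close>

lemma sqrt_ge_quadratic:
  fixes y m :: real
  assumes "y \<ge> 0" "m > 0"
  shows "sqrt y \<ge> sqrt m * (3 / 2 * (y / m) - 1 / 2 * (y\<^sup>2 / m\<^sup>2))"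
proof -
  define q where "q = sqrt (y / m)"
  have q0: "q \<ge> 0" and q2: "y / m = q\<^sup>2" using assms by (auto simp: q_def)
  have "0 \<le> q * ((q - 1)\<^sup>2 * (q + 2))" using q0 by simp
  then have "3 / 2 * q\<^sup>2 - 1 / 2 * (q\<^sup>2)\<^sup>2 \<le> q"
    by (simp add: power2_eq_square algebra_simps)
  then have "sqrt m * (3 / 2 * q\<^sup>2 - 1 / 2 * (q\<^sup>2)\<^sup>2) \<le> sqrt m * q"
    using assms by (intro mult_left_mono) auto
  also have "sqrt m * q = sqrt y" using assms by (simp add: q_def real_sqrt_divide)
  finally show ?thesis by (simp add: q2[symmetric] power_divide)
qed

text \<open>Let S be the standard deviation and A the mean of the squares, which is S^2 plus the
  squared mean. The upper bound is 2 S <= S^2 + 1 <= A + 1. The lower one combines sqrt A <= S +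
  |mean| with a weighted Young inequality, so that only the squared mean enters.\<close>

lemma sample_sd_bounds:
  assumes n: "n > 0"
  shows "sample_sd n x \<le> (1 / real n * (\<Sum>t<n. (x t)\<^sup>2) + 1) / 2"
    and "sqrt (1 / real n * (\<Sum>t<n. (x t)\<^sup>2)) - (sqrt (real n) * (sample_mean n x)\<^sup>2 + 1 / sqrt (real n)) / 2
           \<le> sample_sd n x"
proof -
  let ?A = "1 / real n * (\<Sum>t<n. (x t)\<^sup>2)" and ?m = "sample_mean n x"
  have sq: "?A = (sample_sd n x)\<^sup>2 + ?m\<^sup>2" using sample_sd_square[OF n, of x] by simp
  have "0 \<le> (sample_sd n x - 1)\<^sup>2" by simp
  then have "2 * sample_sd n x \<le> (sample_sd n x)\<^sup>2 + 1" unfolding power2_diff by simp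
  then have "2 * sample_sd n x \<le> (sample_sd n x)\<^sup>2 + ?m\<^sup>2 + 1" using zero_le_power2[of ?m] by linarith
  then show "sample_sd n x \<le> (?A + 1) / 2" unfolding sq by simp
  have le: "sqrt ?A \<le> sample_sd n x + \<bar>?m\<bar>"
    unfolding sq using sqrt_add_le_add_sqrt[of "(sample_sd n x)\<^sup>2" "?m\<^sup>2"] sample_sd_nonneg[of n x] by simp
  \<comment> \<open>The weight \<open>r = sqrt (real n)\<close> chosen below balances the two terms:
    for a standardized sample the squared mean has expectation \<open>1 / real n\<close>.\<close>
  have "2 * \<bar>?m\<bar> \<le> r * ?m\<^sup>2 + 1 / r" if r: "r > 0" for r
  proof -
    have "r * (q - 1 / r)\<^sup>2 = r * q\<^sup>2 + 1 / r - 2 * q" for q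
      using r by (simp add: field_simps power2_eq_square)
    from this[of "\<bar>?m\<bar>"] have "r * (\<bar>?m\<bar> - 1 / r)\<^sup>2 = r * ?m\<^sup>2 + 1 / r - 2 * \<bar>?m\<bar>" by simp
    moreover have "0 \<le> r * (\<bar>?m\<bar> - 1 / r)\<^sup>2" using r by simp
    ultimately show ?thesis by linarith
  qed
  from this[of "sqrt (real n)"] n
  have "\<bar>?m\<bar> \<le> (sqrt (real n) * ?m\<^sup>2 + 1 / sqrt (real n)) / 2" by simp
  then have "sqrt ?A - (sqrt (real n) * ?m\<^sup>2 + 1 / sqrt (real n)) / 2 \<le> sqrt ?A - \<bar>?m\<bar>"
    by (rule diff_left_mono)
  also have "\<dots> \<le> sample_sd n x" using le by simp
  finally show "sqrt ?A - (sqrt (real n) * ?m\<^sup>2 + 1 / sqrt (real n)) / 2 \<le> sample_sd n x" .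
qed

text \<open>
  Only second moments are available, so the law of large numbers for the squares is applied to the
  truncations at \<open>M\<close>, in the form of a lower bound for the expected square root.
\<close>

lemma sample_sd_expectation_tendsto:
  fixes Q :: "real measure"
  assumes Q: "prob_space Q" and sets: "sets Q = sets borel"
    and mean: "has_bochner_integral Q (\<lambda>z. z) 0"
    and var: "has_bochner_integral Q (\<lambda>z. z\<^sup>2) 1"
  shows "(\<lambda>n. LINT x|Pi\<^sub>M {..<n} (\<lambda>_. Q). sample_sd n x) \<longlonglongrightarrow> 1"
proof -
  interpret Q: prob_space Q by fact
  let ?P = "\<lambda>n. Pi\<^sub>M {..<n} (\<lambda>_. Q)"
  have P: "prob_space (?P n)" for n :: nat by (intro prob_space_PiM Q)
  have one: "has_bochner_integral (?P n) (\<lambda>_. c) c" for n :: nat and c :: real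
    using prob_space.prob_space[OF P[of n]] prob_space.finite_measure[OF P[of n]]
    by (simp add: has_bochner_integral_iff finite_measure.integrable_const)
  have mid: "has_bochner_integral (?P n) (\<lambda>x. 1 / real n * (\<Sum>t<n. g (x t))) m"
    if "has_bochner_integral Q g m" "n > 0" for g m and n :: nat
  proof -
    have "has_bochner_integral (?P n) (\<lambda>x. 1 / real n * (\<Sum>t<n. g (x t))) (1 / real n * (\<Sum>t<n. m))"
      by (intro has_bochner_integral_mult_right has_bochner_integral_sum iid_component_moment Q that) auto
    then show ?thesis using that by simp
  qed
  \<comment> \<open>The upper bound of \<open>sample_sd_bounds\<close> has expectation exactly 1,
    which yields both the integrability of \<open>sample_sd n\<close> and the bound
    \<open>le1\<close>.\<close>
  have up: "has_bochner_integral (?P n) (\<lambda>x. (1 / real n * (\<Sum>t<n. (x t)\<^sup>2) + 1) / 2) 1" if "n > 0" for n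
    using has_bochner_integral_divide[OF has_bochner_integral_add[OF mid[OF var that] one[of _ 1]], of 2] by simp
  have int: "integrable (?P n) (sample_sd n)" if n: "n > 0" for n
  proof (rule Bochner_Integration.integrable_bound)
    show "integrable (?P n) (\<lambda>x. (1 / real n * (\<Sum>t<n. (x t)\<^sup>2) + 1) / 2)"
      using up[OF n] by (simp only: has_bochner_integral_iff)
    show "AE x in ?P n. norm (sample_sd n x) \<le> norm ((1 / real n * (\<Sum>t<n. (x t)\<^sup>2) + 1) / 2)"
      using sample_sd_bounds(1)[OF n] sample_sd_nonneg[of n]
      by (intro AE_I2) (smt (verit) real_norm_def)
  qed (use sets in measurable)
  have le1: "(LINT x|?P n. sample_sd n x) \<le> 1" if n: "n > 0" for n
    using integral_mono[OF int[OF n] _ sample_sd_bounds(1)[OF n]] up[OF n]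
    by (simp add: has_bochner_integral_iff)
  \<comment> \<open>The truncated square is bounded and so has a second moment \<open>v M\<close>,
    whereas the fourth moment of \<open>Q\<close> may be infinite.\<close>
  define g where "g = (\<lambda>M z::real. min (z\<^sup>2) (real M))"
  define m where "m = (\<lambda>M. LINT z|Q. g M z)"
  define v where "v = (\<lambda>M. LINT z|Q. (g M z)\<^sup>2)"
  have [measurable]: "g M \<in> borel_measurable Q" for M
  proof -
    have "g M \<in> borel_measurable borel" unfolding g_def by measurable
    then show ?thesis using measurable_cong_sets[OF sets refl] by blast
  qed
  have gb: "\<bar>g M z\<bar> \<le> real M" "\<bar>g M z\<bar> \<le> z\<^sup>2" for M z by (auto simp: g_def)
  have gm: "has_bochner_integral Q (g M) (m M)" for M
    unfolding has_bochner_integral_iff m_def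
    using gb by (intro conjI refl Q.integrable_const_bound[where B = "real M"] AE_I2) auto
  have gv: "has_bochner_integral Q (\<lambda>z. (g M z)\<^sup>2) (v M)" for M
    unfolding has_bochner_integral_iff v_def
    using gb by (intro conjI refl Q.integrable_const_bound[where B = "(real M)\<^sup>2"] AE_I2)
      (auto simp: abs_le_square_iff[symmetric])
  have mlim: "m \<longlonglongrightarrow> 1"
  proof -
    have "m \<longlonglongrightarrow> (LINT z|Q. z\<^sup>2)"
      unfolding m_def
    proof (rule integral_dominated_convergence[where w = "\<lambda>z. z\<^sup>2"])
      show "AE z in Q. (\<lambda>M. g M z) \<longlonglongrightarrow> z\<^sup>2"
      proof (rule AE_I2)
        fix z
        have "\<forall>\<^sub>F M in sequentially. real M > z\<^sup>2"
          using filterlim_real_sequentially by (simp add: filterlim_at_top_dense)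
        then have "\<forall>\<^sub>F M in sequentially. g M z = z\<^sup>2"
          by eventually_elim (simp add: g_def)
        then show "(\<lambda>M. g M z) \<longlonglongrightarrow> z\<^sup>2" by (rule tendsto_eventually)
      qed
    qed (use var gb in \<open>auto simp: has_bochner_integral_iff\<close>)
    then show ?thesis using var by (simp add: has_bochner_integral_iff)
  qed
  \<comment> \<open>The expectation of the quadratic bound at the average of the truncated squares,
    expanded around its mean \<open>m M\<close>. The correction for the sample mean consists of two
    terms that contribute half of \<open>1 / sqrt (real n)\<close> each.\<close>
  have lower: "sqrt (m M) * (3 / 2 - 1 / 2 * (((m M)\<^sup>2 + (v M - (m M)\<^sup>2) / real n) / (m M)\<^sup>2)) - 1 / sqrt (real n)
      \<le> (LINT x|?P n. sample_sd n x)" if n: "n > 0" and m0: "m M > 0" for n M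
  proof -
    let ?A = "\<lambda>x. 1 / real n * (\<Sum>t<n. g M (x t))"
    let ?L = "\<lambda>x. sqrt (m M) * (3 / 2 * (?A x / m M) - 1 / 2 * ((?A x)\<^sup>2 / (m M)\<^sup>2))
        - (sqrt (real n) * (sample_mean n x)\<^sup>2 + 1 / sqrt (real n)) / 2"
    have "has_bochner_integral (?P n) ?L
        (sqrt (m M) * (3 / 2 * (m M / m M) - 1 / 2 * (((m M)\<^sup>2 + (v M - (m M)\<^sup>2) / real n) / (m M)\<^sup>2))
          - (sqrt (real n) * (0\<^sup>2 + (1 - 0\<^sup>2) / real n) + 1 / sqrt (real n)) / 2)"
      unfolding sample_mean_def
      by (intro has_bochner_integral_diff has_bochner_integral_mult_right has_bochner_integral_divide
          has_bochner_integral_add one mid iid_mean_square Q gm gv mean var n)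
    moreover have "?L x \<le> sample_sd n x" for x
    proof -
      have "0 \<le> ?A x" by (auto simp: g_def intro!: divide_nonneg_nonneg sum_nonneg)
      then have "sqrt (m M) * (3 / 2 * (?A x / m M) - 1 / 2 * ((?A x)\<^sup>2 / (m M)\<^sup>2)) \<le> sqrt (?A x)"
        by (rule sqrt_ge_quadratic[OF _ m0])
      also have "\<dots> \<le> sqrt (1 / real n * (\<Sum>t<n. (x t)\<^sup>2))"
        by (intro real_sqrt_le_mono mult_left_mono sum_mono) (auto simp: g_def)
      finally show ?thesis using sample_sd_bounds(2)[OF n, of x] by linarith
    qed
    ultimately have "(sqrt (m M) * (3 / 2 * (m M / m M) - 1 / 2 * (((m M)\<^sup>2 + (v M - (m M)\<^sup>2) / real n) / (m M)\<^sup>2))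
          - (sqrt (real n) * (0\<^sup>2 + (1 - 0\<^sup>2) / real n) + 1 / sqrt (real n)) / 2) \<le> (LINT x|?P n. sample_sd n x)"
      by (metis (no_types, lifting) has_bochner_integral_iff int[OF n] integral_mono)
    moreover have "sqrt (real n) * ((1 - 0\<^sup>2) / real n) = 1 / sqrt (real n)"
      using n by (simp add: field_simps)
    ultimately show ?thesis using m0 by simp
  qed
  show "(\<lambda>n. LINT x|?P n. sample_sd n x) \<longlonglongrightarrow> 1"
  proof (rule order_tendstoI)
    fix a :: real assume a: "a < 1"
    \<comment> \<open>The order of the limits matters: first \<open>M\<close> is fixed with
      \<open>a < sqrt (m M)\<close>, then \<open>n\<close> grows and the lower bound tends to
      \<open>sqrt (m M)\<close>.\<close>
    have "(\<lambda>M. sqrt (m M)) \<longlonglongrightarrow> 1" using tendsto_real_sqrt[OF mlim] by simp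
    from order_tendstoD(1)[OF this a] order_tendstoD(1)[OF mlim zero_less_one]
    have "\<forall>\<^sub>F M in sequentially. a < sqrt (m M) \<and> 0 < m M" by (rule eventually_conj)
    then obtain M where M: "a < sqrt (m M)" "0 < m M"
      using eventually_happens by force
    have "(\<lambda>n. sqrt (m M) * (3 / 2 - 1 / 2 * (((m M)\<^sup>2 + (v M - (m M)\<^sup>2) / real n) / (m M)\<^sup>2)) - 1 / sqrt (real n))
        \<longlonglongrightarrow> sqrt (m M) * (3 / 2 - 1 / 2 * (((m M)\<^sup>2 + 0) / (m M)\<^sup>2)) - 0"
      by (intro tendsto_intros tendsto_divide_0[OF tendsto_const] filterlim_at_top_imp_at_infinity
          filterlim_real_sequentially filterlim_compose[OF sqrt_at_top]) (use M in auto)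
    then have "\<forall>\<^sub>F n in sequentially. a < sqrt (m M) * (3 / 2 - 1 / 2 * (((m M)\<^sup>2 + (v M - (m M)\<^sup>2) / real n) / (m M)\<^sup>2)) - 1 / sqrt (real n)"
      by (rule order_tendstoD(1)) (use M in simp)
    with eventually_gt_at_top[of 0] show "\<forall>\<^sub>F n in sequentially. a < (LINT x|?P n. sample_sd n x)"
      by eventually_elim (use lower M(2) in \<open>blast intro: less_le_trans\<close>)
  next
    fix a :: real assume a: "1 < a"
    show "\<forall>\<^sub>F n in sequentially. (LINT x|?P n. sample_sd n x) < a"
      using eventually_gt_at_top[of 0] by eventually_elim (use le1 a in \<open>blast intro: le_less_trans\<close>)
  qed
qed

subsection \<open>Location-scale samples\<close>

text \<open>A product measure is determined by its values on boxes, and there the integral of the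
  product density factorizes.\<close>

lemma sample_measure_eq_PiM:
  assumes [measurable]: "(\<lambda>x. p x \<theta>) \<in> borel_measurable borel"
    and nonneg: "\<And>x. 0 \<le> p x \<theta>" and Q: "prob_space (obs_measure p \<theta>)"
  shows "sample_measure p n \<theta> = Pi\<^sub>M {..<n} (\<lambda>_. obs_measure p \<theta>)"
proof -
  interpret Q: prob_space "obs_measure p \<theta>" by fact
  interpret product_sigma_finite "\<lambda>_::nat. obs_measure p \<theta>" by standard
  interpret L: product_sigma_finite "\<lambda>_::nat. lborel :: real measure" by standard
  have sets_obs: "sets (obs_measure p \<theta>) = sets borel" by (simp add: obs_measure_def)
  show ?thesis
  proof (rule PiM_eqI)
    have "sets (sample_measure p n \<theta>) = sets (Pi\<^sub>M {..<n} (\<lambda>_. lborel :: real measure))"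
      by (simp add: sample_measure_def)
    also have "\<dots> = sets (Pi\<^sub>M {..<n} (\<lambda>_. obs_measure p \<theta>))"
      by (intro sets_PiM_cong) (auto simp: sets_obs)
    finally show "sets (sample_measure p n \<theta>) = sets (Pi\<^sub>M {..<n} (\<lambda>_. obs_measure p \<theta>))" .
    fix A assume A: "\<And>i. i \<in> {..<n} \<Longrightarrow> A i \<in> sets (obs_measure p \<theta>)"
    then have [measurable]: "\<And>i. i < n \<Longrightarrow> A i \<in> sets borel" by (simp add: sets_obs)
    have "emeasure (sample_measure p n \<theta>) (Pi\<^sub>E {..<n} A) =
        (\<integral>\<^sup>+x. ennreal (\<Prod>t<n. p (x t) \<theta>) * indicator (Pi\<^sub>E {..<n} A) x \<partial>Pi\<^sub>M {..<n} (\<lambda>_. lborel))"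
      unfolding sample_measure_def by (subst emeasure_density) (auto intro!: sets_PiM_I_finite)
    also have "\<dots> = (\<integral>\<^sup>+x. (\<Prod>t<n. ennreal (p (x t) \<theta>) * indicator (A t) (x t)) \<partial>Pi\<^sub>M {..<n} (\<lambda>_. lborel))"
    proof (rule nn_integral_cong)
      fix x :: "nat \<Rightarrow> real" assume "x \<in> space (Pi\<^sub>M {..<n} (\<lambda>_. lborel))"
      then have "indicator (Pi\<^sub>E {..<n} A) x = (\<Prod>t<n. indicator (A t) (x t) :: ennreal)"
        by (auto simp: space_PiM PiE_iff indicator_def prod_zero_iff split: if_splits)
      then show "ennreal (\<Prod>t<n. p (x t) \<theta>) * indicator (Pi\<^sub>E {..<n} A) x =
          (\<Prod>t<n. ennreal (p (x t) \<theta>) * indicator (A t) (x t))"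
        using nonneg by (simp add: prod.distrib prod_ennreal)
    qed
    also have "\<dots> = (\<Prod>t<n. \<integral>\<^sup>+x. ennreal (p x \<theta>) * indicator (A t) x \<partial>lborel)"
      by (rule L.product_nn_integral_prod) auto
    also have "\<dots> = (\<Prod>t<n. emeasure (obs_measure p \<theta>) (A t))"
      unfolding obs_measure_def by (intro prod.cong) (auto simp: emeasure_density)
    finally show "emeasure (sample_measure p n \<theta>) (Pi\<^sub>E {..<n} A) = (\<Prod>t<n. emeasure (obs_measure p \<theta>) (A t))" .
  qed auto
qed

lemma location_scale_measurable [measurable]:
  assumes [measurable]: "f \<in> borel_measurable borel"
  shows "(\<lambda>x. location_scale f x \<theta>) \<in> borel_measurable borel"
  unfolding location_scale_def by measurable

text \<open>Under the substitution \<open>x = \<theta> $ 1 + \<theta> $ 2 * z\<close> the Jacobian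
  cancels the factor \<open>1 / \<theta> $ 2\<close> of the density.\<close>

lemma obs_measure_location_scale:
  assumes [measurable]: "f \<in> borel_measurable borel" and s: "\<theta> $ 2 > 0"
  shows "obs_measure (location_scale f) \<theta> =
    distr (density lborel (\<lambda>z. ennreal (f z))) borel (\<lambda>z. \<theta> $ 1 + \<theta> $ 2 * z)"
proof (rule measure_eqI)
  fix A assume "A \<in> sets (obs_measure (location_scale f) \<theta>)"
  then have [measurable]: "A \<in> sets borel" by (simp add: obs_measure_def)
  have [measurable]: "(\<lambda>z. \<theta> $ 1 + \<theta> $ 2 * z) -` A \<in> sets borel"
    using measurable_sets_borel[of "\<lambda>z. \<theta> $ 1 + \<theta> $ 2 * z" borel A] by simp
  have "emeasure (obs_measure (location_scale f) \<theta>) A =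
      (\<integral>\<^sup>+x. ennreal (location_scale f x \<theta>) * indicator A x \<partial>lborel)"
    unfolding obs_measure_def by (subst emeasure_density) auto
  also have "\<dots> = ennreal \<bar>\<theta> $ 2\<bar> * (\<integral>\<^sup>+z. ennreal (location_scale f (\<theta> $ 1 + \<theta> $ 2 * z) \<theta>) *
      indicator A (\<theta> $ 1 + \<theta> $ 2 * z) \<partial>lborel)"
    by (rule nn_integral_real_affine) (use s in auto)
  also have "\<dots> = (\<integral>\<^sup>+z. ennreal (f z) * indicator A (\<theta> $ 1 + \<theta> $ 2 * z) \<partial>lborel)"
    using s by (subst nn_integral_cmult[symmetric])
      (auto simp: location_scale_def mult.assoc[symmetric] ennreal_mult'[symmetric] intro!: nn_integral_cong)
  also have "\<dots> = emeasure (distr (density lborel (\<lambda>z. ennreal (f z))) borel (\<lambda>z. \<theta> $ 1 + \<theta> $ 2 * z)) A"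
    by (subst emeasure_distr) (auto simp: emeasure_density indicator_def intro!: nn_integral_cong)
  finally show "emeasure (obs_measure (location_scale f) \<theta>) A =
      emeasure (distr (density lborel (\<lambda>z. ennreal (f z))) borel (\<lambda>z. \<theta> $ 1 + \<theta> $ 2 * z)) A" .
qed (simp add: obs_measure_def)

lemma prob_space_density_lborel:
  fixes f :: "real \<Rightarrow> real"
  assumes "\<And>x. 0 \<le> f x" and "has_bochner_integral lborel f 1"
  shows "prob_space (density lborel (\<lambda>z. ennreal (f z)))"
proof (rule prob_spaceI)
  have [measurable]: "f \<in> borel_measurable borel" using assms by (auto simp: has_bochner_integral_iff)
  have "(\<integral>\<^sup>+z. ennreal (f z) \<partial>lborel) = ennreal 1"
    using assms nn_integral_eq_integral[of lborel f] by (simp add: has_bochner_integral_iff)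
  then show "emeasure (density lborel (\<lambda>z. ennreal (f z))) (space (density lborel (\<lambda>z. ennreal (f z)))) = 1"
    by (subst emeasure_density) auto
qed

text \<open>Reduces every parameter to one standardized product measure, so that all dependence on
  \<open>\<theta>\<close> sits in the affine map.\<close>

lemma sample_measure_location_scale:
  assumes f [measurable]: "f \<in> borel_measurable borel" and nonneg: "\<And>x. 0 \<le> f x"
    and total: "has_bochner_integral lborel f 1" and s: "\<theta> $ 2 > 0"
  shows "prob_space (sample_measure (location_scale f) n \<theta>)"
    and "sample_measure (location_scale f) n \<theta> =
      distr (Pi\<^sub>M {..<n} (\<lambda>_. density lborel (\<lambda>z. ennreal (f z))))
        (Pi\<^sub>M {..<n} (\<lambda>_. obs_measure (location_scale f) \<theta>))
        (compose {..<n} (\<lambda>z. \<theta> $ 1 + \<theta> $ 2 * z))"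
proof -
  let ?Q = "density lborel (\<lambda>z. ennreal (f z))" and ?O = "obs_measure (location_scale f) \<theta>"
    and ?g = "\<lambda>z. \<theta> $ 1 + \<theta> $ 2 * z"
  have Q: "prob_space ?Q" by (rule prob_space_density_lborel[OF nonneg total])
  have O: "prob_space ?O"
    unfolding obs_measure_location_scale[OF f s] by (rule prob_space.prob_space_distr[OF Q]) simp
  have S: "sample_measure (location_scale f) n \<theta> = Pi\<^sub>M {..<n} (\<lambda>_. ?O)"
    by (rule sample_measure_eq_PiM[OF _ _ O]) (use nonneg s in \<open>auto simp: location_scale_def\<close>)
  show "prob_space (sample_measure (location_scale f) n \<theta>)"
    unfolding S by (intro prob_space_PiM O)
  \<comment> \<open>The target of \<open>distr\<close> matters only through its space and its
    measurable sets, so \<open>borel\<close> may be replaced by \<open>?O\<close>.\<close>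
  have "distr ?Q ?O ?g = ?O"
    using obs_measure_location_scale[OF f s] distr_cong[of ?Q ?Q ?O borel ?g ?g]
    by (simp add: obs_measure_def)
  then show "sample_measure (location_scale f) n \<theta> =
      distr (Pi\<^sub>M {..<n} (\<lambda>_. ?Q)) (Pi\<^sub>M {..<n} (\<lambda>_. ?O)) (compose {..<n} ?g)"
    unfolding S by (subst distr_PiM_finite_prob_space') (use Q O in \<open>auto simp: obs_measure_def\<close>)
qed

text \<open>After pulling back to the standardized sample, the mean transforms by the affine map,
  and the standard deviation ignores the shift and scales.\<close>

lemma location_scale_estimator_expectation:
  assumes f [measurable]: "f \<in> borel_measurable borel" and nonneg: "\<And>x. 0 \<le> f x"
    and total: "has_bochner_integral lborel f 1"
    and mean: "has_bochner_integral lborel (\<lambda>x. x * f x) 0"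
    and n: "n > 0" and s: "\<theta> $ 2 > 0"
  shows "(LINT x|sample_measure (location_scale f) n \<theta>. sample_mean n x) = \<theta> $ 1"
    and "(LINT x|sample_measure (location_scale f) n \<theta>. sample_sd n x) =
      \<theta> $ 2 * (LINT x|Pi\<^sub>M {..<n} (\<lambda>_. density lborel (\<lambda>z. ennreal (f z))). sample_sd n x)"
proof -
  let ?Q = "density lborel (\<lambda>z. ennreal (f z))" and ?O = "obs_measure (location_scale f) \<theta>"
    and ?g = "\<lambda>z. \<theta> $ 1 + \<theta> $ 2 * z"
  have Q: "prob_space ?Q" by (rule prob_space_density_lborel[OF nonneg total])
  note S = sample_measure_location_scale(2)[OF f nonneg total s, of n]
  have [measurable]: "compose {..<n} ?g \<in> Pi\<^sub>M {..<n} (\<lambda>_. ?Q) \<rightarrow>\<^sub>M Pi\<^sub>M {..<n} (\<lambda>_. ?O)"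
    unfolding compose_def by (rule measurable_restrict) (auto simp: obs_measure_def)
  have [measurable]: "sample_mean n \<in> borel_measurable (Pi\<^sub>M {..<n} (\<lambda>_. ?O))"
    "sample_sd n \<in> borel_measurable (Pi\<^sub>M {..<n} (\<lambda>_. ?O))"
    by (auto intro!: sample_mean_measurable sample_sd_measurable simp: obs_measure_def)
  have id: "has_bochner_integral ?Q (\<lambda>z. z) 0"
    by (rule has_bochner_integral_density) (use mean nonneg in \<open>auto simp: mult.commute\<close>)
  have "has_bochner_integral (Pi\<^sub>M {..<n} (\<lambda>_. ?Q)) (\<lambda>x. 1 / real n * (\<Sum>t<n. x t)) (1 / real n * (\<Sum>t<n. 0))"
    by (intro has_bochner_integral_mult_right has_bochner_integral_sum iid_component_moment Q id) auto
  then have c: "has_bochner_integral (Pi\<^sub>M {..<n} (\<lambda>_. ?Q)) (sample_mean n) 0"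
    by (simp add: sample_mean_def[abs_def])
  interpret P: prob_space "Pi\<^sub>M {..<n} (\<lambda>_. ?Q)" by (intro prob_space_PiM Q)
  have "(LINT x|sample_measure (location_scale f) n \<theta>. sample_mean n x) =
      (LINT x|Pi\<^sub>M {..<n} (\<lambda>_. ?Q). \<theta> $ 1 + \<theta> $ 2 * sample_mean n x)"
    unfolding S by (subst integral_distr) (auto simp: sample_mean_affine[OF n])
  also have "\<dots> = \<theta> $ 1"
    using c by (subst Bochner_Integration.integral_add) (auto simp: has_bochner_integral_iff P.prob_space)
  finally show "(LINT x|sample_measure (location_scale f) n \<theta>. sample_mean n x) = \<theta> $ 1" .
  show "(LINT x|sample_measure (location_scale f) n \<theta>. sample_sd n x) =
      \<theta> $ 2 * (LINT x|Pi\<^sub>M {..<n} (\<lambda>_. ?Q). sample_sd n x)"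
    unfolding S using s by (subst integral_distr) (auto simp: sample_sd_affine[OF n])
qed

lemma expectation_jacobian_location_scale:
  assumes f: "f \<in> borel_measurable borel" and nonneg: "\<And>x. 0 \<le> f x"
    and total: "has_bochner_integral lborel f 1"
    and mean: "has_bochner_integral lborel (\<lambda>x. x * f x) 0"
    and n: "n > 0" and s: "\<theta> $ 2 > 0"
  shows "expectation_jacobian (location_scale f) n (wasserstein_estimator n) \<theta> =
    (\<chi> i j. if i = j then
       (if i = 1 then 1 else LINT x|Pi\<^sub>M {..<n} (\<lambda>_. density lborel (\<lambda>z. ennreal (f z))). sample_sd n x) else 0)"
proof -
  define c where "c = (LINT x|Pi\<^sub>M {..<n} (\<lambda>_. density lborel (\<lambda>z. ennreal (f z))). sample_sd n x)"
  note E = location_scale_estimator_expectation[OF f nonneg total mean n, folded c_def]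
  \<comment> \<open>The formulas \<open>E\<close> need a positive scale; it persists for small
    \<open>h\<close>, which is enough for a derivative at 0.\<close>
  have pos: "\<forall>\<^sub>F h in nhds 0. (\<theta> + h *\<^sub>R axis i 1) $ 2 > 0" for i :: 2
    by (rule order_tendstoD(1)[where y = "\<theta> $ 2"]) (use s in \<open>auto intro!: tendsto_eq_intros filterlim_ident\<close>)
  have m: "deriv (\<lambda>h. LINT x|sample_measure (location_scale f) n (\<theta> + h *\<^sub>R axis i 1). sample_mean n x) 0
      = axis i 1 $ 1" for i :: 2
  proof (rule DERIV_imp_deriv)
    have ev: "\<forall>\<^sub>F h in nhds 0. (LINT x|sample_measure (location_scale f) n (\<theta> + h *\<^sub>R axis i 1). sample_mean n x)
        = \<theta> $ 1 + h * axis i 1 $ 1"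
      using pos[of i] by eventually_elim (simp add: E(1))
    have D: "((\<lambda>h. \<theta> $ 1 + h * axis i 1 $ 1) has_real_derivative axis i 1 $ 1) (at 0)"
      by (auto intro!: derivative_eq_intros)
    show "((\<lambda>h. LINT x|sample_measure (location_scale f) n (\<theta> + h *\<^sub>R axis i 1). sample_mean n x)
        has_real_derivative axis i 1 $ 1) (at 0)"
      by (rule iffD2[OF DERIV_cong_ev[OF refl ev refl] D])
  qed
  have d: "deriv (\<lambda>h. LINT x|sample_measure (location_scale f) n (\<theta> + h *\<^sub>R axis i 1). sample_sd n x) 0
      = axis i 1 $ 2 * c" for i :: 2
  proof (rule DERIV_imp_deriv)
    have ev: "\<forall>\<^sub>F h in nhds 0. (LINT x|sample_measure (location_scale f) n (\<theta> + h *\<^sub>R axis i 1). sample_sd n x)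
        = (\<theta> $ 2 + h * axis i 1 $ 2) * c"
      using pos[of i] by eventually_elim (simp add: E(2))
    have D: "((\<lambda>h. (\<theta> $ 2 + h * axis i 1 $ 2) * c) has_real_derivative axis i 1 $ 2 * c) (at 0)"
      by (auto intro!: derivative_eq_intros)
    show "((\<lambda>h. LINT x|sample_measure (location_scale f) n (\<theta> + h *\<^sub>R axis i 1). sample_sd n x)
        has_real_derivative axis i 1 $ 2 * c) (at 0)"
      by (rule iffD2[OF DERIV_cong_ev[OF refl ev refl] D])
  qed
  have "(deriv (\<lambda>h. LINT x|sample_measure (location_scale f) n (\<theta> + h *\<^sub>R axis i 1). wasserstein_estimator n x $ j) 0)
      = (if i = j then (if i = 1 then 1 else c) else 0)" for i j :: 2
    using m[of i] d[of i] exhaust_2[of i] exhaust_2[of j] by (auto simp: axis_def)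
  then show ?thesis by (simp add: expectation_jacobian_def vec_eq_iff c_def)
qed

subsection \<open>Wasserstein variance and information\<close>

text \<open>Integrating out coordinate 0 first, the slice of the exceptional set is contained in the
  single point \<open>x 1\<close>, a null set.\<close>

lemma AE_PiM_lborel_distinct:
  assumes "n \<ge> 2"
  shows "AE x in Pi\<^sub>M {..<n} (\<lambda>_. lborel :: real measure). x 0 \<noteq> x (1::nat)"
proof -
  interpret product_sigma_finite "\<lambda>_::nat. lborel :: real measure" by standard
  define J where "J = {1..<n}"
  have I: "{..<n} = insert 0 J" and J: "finite J" "0 \<notin> J" using assms by (auto simp: J_def)
  have c: "(\<lambda>x. x i) \<in> borel_measurable (Pi\<^sub>M {..<n} (\<lambda>_. lborel :: real measure))" if "i < n" for i
    using measurable_component_singleton[of i "{..<n}" "\<lambda>_. lborel :: real measure"] that by simp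
  define N where "N = {x \<in> space (Pi\<^sub>M {..<n} (\<lambda>_. lborel :: real measure)). x 0 = x 1}"
  have N: "N \<in> sets (Pi\<^sub>M {..<n} (\<lambda>_. lborel))"
    unfolding N_def using c[of 0] c[of 1] assms by (intro borel_measurable_eq) auto
  have "emeasure (Pi\<^sub>M {..<n} (\<lambda>_. lborel)) N = (\<integral>\<^sup>+x. indicator N x \<partial>Pi\<^sub>M (insert 0 J) (\<lambda>_. lborel))"
    using N by (simp add: I[symmetric])
  also have "\<dots> = (\<integral>\<^sup>+x. (\<integral>\<^sup>+y. indicator N (x(0 := y)) \<partial>lborel) \<partial>Pi\<^sub>M J (\<lambda>_. lborel))"
    by (rule product_nn_integral_insert) (use N J in \<open>auto simp: I[symmetric]\<close>)
  also have "\<dots> \<le> (\<integral>\<^sup>+x. (\<integral>\<^sup>+y. indicator {x 1} y \<partial>lborel) \<partial>Pi\<^sub>M J (\<lambda>_. lborel :: real measure))"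
    by (intro nn_integral_mono) (auto simp: N_def indicator_def)
  also have "\<dots> = 0" by simp
  finally have "N \<in> null_sets (Pi\<^sub>M {..<n} (\<lambda>_. lborel))" using N by (simp add: null_sets_def)
  then show ?thesis by (rule AE_I') (auto simp: N_def)
qed

section \<open>Gradient and Wasserstein variance of the estimator\<close>

lemma sample_sd_eq_0_iff:
  assumes "n > 0"
  shows "sample_sd n x = 0 \<longleftrightarrow> (\<forall>t<n. x t = sample_mean n x)"
  using assms by (simp add: sample_sd_def sum_nonneg_eq_0_iff) auto

lemma sample_mean_has_partial:
  assumes "t < n"
  shows "((\<lambda>s. sample_mean n (x(t := s))) has_real_derivative 1 / real n) (at a)"
proof -
  have "((\<lambda>s. (x(t := s)) u) has_real_derivative (if u = t then 1 else 0)) (at a)" for u by simp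
  then have "((\<lambda>s. 1 / real n * (\<Sum>u<n. (x(t := s)) u)) has_real_derivative
      1 / real n * (\<Sum>u<n. if u = t then 1 else 0)) (at a)"
    by (intro DERIV_cmult DERIV_sum)
  then show ?thesis using assms by (simp add: sample_mean_def)
qed

text \<open>The moving mean adds \<open>- 1 / real n\<close> to the derivative of every deviation,
  but the deviations sum to 0, so only the term of index \<open>t\<close> survives in the derivative
  of the variance.\<close>

lemma sample_sd_has_partial:
  assumes t: "t < n" and nz: "sample_sd n x \<noteq> 0"
  shows "((\<lambda>s. sample_sd n (x(t := s))) has_real_derivative
           (x t - sample_mean n x) / (real n * sample_sd n x)) (at (x t))"
proof -
  let ?m = "sample_mean n x"
  let ?V = "\<lambda>s. 1 / real n * (\<Sum>u<n. ((x(t := s)) u - sample_mean n (x(t := s)))\<^sup>2)"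
  have n: "n > 0" using t by simp
  have V: "?V (x t) > 0"
    using nz sample_sd_square_eq_mean_sum[of n x] by (metis fun_upd_triv zero_less_power2)
  have D: "((\<lambda>s. (x(t := s)) u) has_real_derivative (if u = t then 1 else 0)) (at (x t))" for u by simp
  have "(?V has_real_derivative 1 / real n * (\<Sum>u<n. 2 * (x u - ?m) * ((if u = t then 1 else 0) - 1 / real n)))
      (at (x t))"
  proof (intro DERIV_cmult DERIV_sum)
    fix u
    show "((\<lambda>s. ((x(t := s)) u - sample_mean n (x(t := s)))\<^sup>2) has_real_derivative
        2 * (x u - ?m) * ((if u = t then 1 else 0) - 1 / real n)) (at (x t))"
      by (rule DERIV_cong[OF DERIV_power[OF DERIV_diff[OF D[of u] sample_mean_has_partial[OF t, of x]], where n = 2]])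
         simp
  qed
  also have "(\<Sum>u<n. 2 * (x u - ?m) * ((if u = t then 1 else 0) - 1 / real n)) =
      (\<Sum>u<n. if u = t then 2 * (x u - ?m) else 0) - 2 / real n * (\<Sum>u<n. x u - ?m)"
    unfolding sum_distrib_left sum_subtractf[symmetric] by (intro sum.cong) (auto simp: field_simps)
  also have "(\<Sum>u<n. x u - ?m) = 0" using n by (simp add: sum_subtractf sample_mean_def)
  also have "(\<Sum>u<n. if u = t then 2 * (x u - ?m) else 0) = 2 * (x t - ?m)" using t by simp
  finally have "(?V has_real_derivative 1 / real n * (2 * (x t - ?m))) (at (x t))"
    by (simp only: mult_zero_right diff_zero)
  from DERIV_chain2[OF DERIV_real_sqrt[OF V] this]
  have "((\<lambda>s. sample_sd n (x(t := s))) has_real_derivative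
      inverse (sample_sd n x) / 2 * (1 / real n * (2 * (x t - ?m)))) (at (x t))"
    by (simp add: sample_sd_def)
  then show ?thesis
    by (rule DERIV_cong) (use n nz in \<open>simp add: divide_simps\<close>)
qed

text \<open>
  Where all observations coincide \<open>sample_sd\<close> has no partial derivatives and \<open>deriv\<close> is a junk
  value. That it is the same at all these points is needed for measurability, because the product
  measure is not complete.
\<close>

lemma sample_sd_partial_diagonal:
  assumes t: "t < n" and z: "sample_sd n x = 0"
  shows "sample_partial t (sample_sd n) x = deriv (\<lambda>s. sqrt (real n - 1) / real n * \<bar>s\<bar>) 0"
proof -
  let ?c = "x t"
  have n: "n > 0" using t by simp
  have x: "x u = ?c" if "u < n" for u
    using z that t sample_sd_eq_0_iff[OF n, of x] by simp
  \<comment> \<open>Moving one of \<open>n\<close> equal observations by \<open>s\<close> gives a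
    multiple of \<open>\<bar>s\<bar>\<close> whose factor depends on \<open>n\<close> only, not on
    \<open>x\<close> or \<open>t\<close>.\<close>
  have sd: "sample_sd n (x(t := ?c + s)) = sqrt (real n - 1) / real n * \<bar>s\<bar>" for s
  proof -
    have "(\<Sum>u<n. g ((x(t := ?c + s)) u)) = g (?c + s) + (real n - 1) * g ?c" for g :: "real \<Rightarrow> real"
    proof -
      have "(\<Sum>u<n. g ((x(t := ?c + s)) u)) = g (?c + s) + (\<Sum>u\<in>{..<n} - {t}. g ((x(t := ?c + s)) u))"
        using t by (subst sum.remove[of _ t]) auto
      also have "(\<Sum>u\<in>{..<n} - {t}. g ((x(t := ?c + s)) u)) = (\<Sum>u\<in>{..<n} - {t}. g ?c)"
        using x by (intro sum.cong) auto
      also have "\<dots> = (real n - 1) * g ?c" using t by (simp add: of_nat_diff)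
      finally show ?thesis .
    qed
    from this[of "\<lambda>y. y"] this[of "\<lambda>y. y\<^sup>2"]
    have "(sample_sd n (x(t := ?c + s)))\<^sup>2 =
        1 / real n * ((?c + s)\<^sup>2 + (real n - 1) * ?c\<^sup>2) - (1 / real n * (?c + s + (real n - 1) * ?c))\<^sup>2"
      by (simp only: sample_sd_square[OF n] sample_mean_def)
    also have "\<dots> = (real n - 1) * s\<^sup>2 / (real n)\<^sup>2"
      using n by (simp add: field_simps power2_eq_square)
    also have "\<dots> = (sqrt (real n - 1) / real n * \<bar>s\<bar>)\<^sup>2"
      using n by (simp add: power_mult_distrib power_divide)
    finally show ?thesis
      using n by (simp add: power2_eq_iff_nonneg sample_sd_nonneg)
  qed
  \<comment> \<open>Unfolding \<open>deriv\<close> makes the shift to 0 valid for the junk value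
    too: the choice is made from equivalent predicates.\<close>
  have "sample_partial t (sample_sd n) x = deriv (\<lambda>s. sample_sd n (x(t := ?c + s))) 0"
    unfolding sample_partial_def deriv_def
    using DERIV_at_within_shift[of "\<lambda>s. sample_sd n (x(t := s))" _ ?c 0 UNIV] by simp
  then show ?thesis unfolding sd .
qed

text \<open>Off the diagonal both gradients have squared length \<open>1 / real n\<close>, the
  second because the squared deviations sum to \<open>n\<close> times the sample variance; they are
  orthogonal because the deviations sum to 0.\<close>

lemma wasserstein_variance_estimator:
  assumes P: "prob_space (sample_measure p n \<theta>)"
    and [measurable]: "(\<lambda>x. p x \<theta>) \<in> borel_measurable borel"
    and n2: "n \<ge> 2"
  shows "wasserstein_variance p n (wasserstein_estimator n) \<theta> = (1 / real n) *\<^sub>R mat 1"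
proof -
  interpret P: prob_space "sample_measure p n \<theta>" by fact
  define k where "k = deriv (\<lambda>s. sqrt (real n - 1) / real n * \<bar>s\<bar>) 0"
  have n: "n > 0" using n2 by simp
  let ?b = "\<lambda>i y. wasserstein_estimator n y $ i"
  let ?F = "\<lambda>i j x. \<Sum>t<n. sample_partial t (?b i) x * sample_partial t (?b j) x"
  have b: "?b 1 = sample_mean n" "?b 2 = sample_sd n" by auto
  have mp: "sample_partial t (sample_mean n) x = 1 / real n" if "t < n" for t x
    unfolding sample_partial_def by (rule DERIV_imp_deriv[OF sample_mean_has_partial[OF that]])
  have sp: "sample_partial t (sample_sd n) x =
      (if sample_sd n x = 0 then k else (x t - sample_mean n x) / (real n * sample_sd n x))"
    if "t < n" for t x
    using sample_sd_partial_diagonal[OF that] DERIV_imp_deriv[OF sample_sd_has_partial[OF that]]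
    by (simp add: k_def sample_partial_def)
  \<comment> \<open>The value of the integrand where \<open>sample_sd n x = 0\<close>, with the junk
    value \<open>k\<close> for each partial derivative of \<open>sample_sd n\<close>.\<close>
  define K :: "2 \<Rightarrow> 2 \<Rightarrow> real" where "K i j = (if i = 1 \<and> j = 1 then 1 / real n else if i = j then real n * k\<^sup>2 else k)" for i j
  have F: "?F i j x = (if sample_sd n x = 0 then K i j else if i = j then 1 / real n else 0)" for i j x
  proof -
    have sum0: "(\<Sum>t<n. x t - sample_mean n x) = 0" using n by (simp add: sum_subtractf sample_mean_def)
    have 11: "?F 1 1 x = 1 / real n"
      unfolding b using n by (simp add: mp field_simps)
    have 12: "(\<Sum>t<n. sample_partial t (sample_mean n) x * sample_partial t (sample_sd n) x) =
        (if sample_sd n x = 0 then k else 0)"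
      using n sum0 by (simp add: mp sp sum_divide_distrib[symmetric])
    have 22: "(\<Sum>t<n. sample_partial t (sample_sd n) x * sample_partial t (sample_sd n) x) =
        (if sample_sd n x = 0 then real n * k\<^sup>2 else 1 / real n)"
    proof (cases "sample_sd n x = 0")
      case False
      have "(\<Sum>t<n. (x t - sample_mean n x)\<^sup>2) = real n * (sample_sd n x)\<^sup>2"
        using n by (simp add: sample_sd_square_eq_mean_sum)
      then have "(\<Sum>t<n. ((x t - sample_mean n x) / (real n * sample_sd n x))\<^sup>2) = 1 / real n"
        using n False by (simp add: power_divide sum_divide_distrib[symmetric] power_mult_distrib)
          (simp add: power2_eq_square)
      then show ?thesis using False by (simp add: sp power2_eq_square)
    qed (simp add: sp power2_eq_square)
    consider "i = 1" "j = 1" | "i = 1" "j = 2" | "i = 2" "j = 1" | "i = 2" "j = 2"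
      using exhaust_2[of i] exhaust_2[of j] by blast
    then show ?thesis
    proof cases
      case 1 then show ?thesis using 11 by (simp add: K_def)
    next
      case 2 then show ?thesis using 12 by (simp add: b K_def)
    next
      case 3 then show ?thesis using 12 by (simp add: b K_def mult.commute)
    next
      case 4 then show ?thesis using 22 by (simp add: b K_def)
    qed
  qed
  have [measurable]: "sample_sd n \<in> borel_measurable (sample_measure p n \<theta>)"
    unfolding sample_measure_def using sample_sd_measurable[of lborel n] by simp
  \<comment> \<open>A zero standard deviation forces \<open>x 0 = x 1\<close>, a Lebesgue null
    event, which a measure with a density does not charge.\<close>
  have AE: "AE x in sample_measure p n \<theta>. sample_sd n x \<noteq> 0"
  proof -
    have [measurable]: "(\<lambda>x. ennreal (\<Prod>t<n. p (x t) \<theta>)) \<in> borel_measurable (Pi\<^sub>M {..<n} (\<lambda>_. lborel))"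
      by measurable
    have "AE x in Pi\<^sub>M {..<n} (\<lambda>_. lborel :: real measure). sample_sd n x \<noteq> 0"
      using AE_PiM_lborel_distinct[OF n2]
    proof eventually_elim
      case (elim x)
      then show ?case using n2 sample_sd_eq_0_iff[OF n, of x] by auto
    qed
    then show ?thesis unfolding sample_measure_def by (subst AE_density) auto
  qed
  have "(LINT x|sample_measure p n \<theta>. ?F i j x) = (if i = j then 1 / real n else 0)" for i j
  proof -
    have "(LINT x|sample_measure p n \<theta>. ?F i j x) =
        (LINT x|sample_measure p n \<theta>. (if i = j then 1 / real n else 0))"
      unfolding F
    proof (rule integral_cong_AE)
      show "AE x in sample_measure p n \<theta>. (if sample_sd n x = 0 then K i j else if i = j then 1 / real n else 0)
          = (if i = j then 1 / real n else 0)"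
        using AE by eventually_elim simp
    qed auto
    then show ?thesis by (simp add: P.prob_space)
  qed
  then show ?thesis
    by (simp add: wasserstein_variance_def vec_eq_iff mat_def)
qed

text \<open>Subtracting the two weak equations leaves \<open>h\<close> with weak derivative zero.
  Square integrability of the score derivatives, combined with \<open>p0\<close> and
  \<open>p2\<close> by Young's inequality, makes \<open>h\<close> and \<open>x * h x\<close>
  integrable as \<open>AE_zero_if_weak_derivative_zero\<close> requires.\<close>

lemma wasserstein_score_unique:
  assumes p [measurable]: "(\<lambda>x. p x \<theta>) \<in> borel_measurable borel" and nonneg: "\<And>x. 0 \<le> p x \<theta>"
    and p0: "integrable (obs_measure p \<theta>) (\<lambda>x. 1 :: real)"
    and p2: "integrable (obs_measure p \<theta>) (\<lambda>x. x\<^sup>2)"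
    and \<Phi>: "wasserstein_score p i \<theta> \<Phi>" and \<Psi>: "wasserstein_score p i \<theta> \<Psi>"
  shows "AE x in obs_measure p \<theta>. deriv \<Phi> x = deriv \<Psi> x"
proof -
  let ?M = "obs_measure p \<theta>"
  have M [simp]: "sets ?M = sets borel" by (simp add: obs_measure_def)
  have meas: "g \<in> borel_measurable ?M \<longleftrightarrow> g \<in> borel_measurable borel" for g :: "real \<Rightarrow> real"
    by (rule arg_cong[where f = "\<lambda>A. g \<in> A"]) (rule measurable_cong_sets, auto)
  have dens: "integrable ?M g \<longleftrightarrow> integrable lborel (\<lambda>x. p x \<theta> * g x)"
    "(LINT x|?M. g x) = (LINT x|lborel. p x \<theta> * g x)"
    if [measurable]: "g \<in> borel_measurable borel" for g :: "real \<Rightarrow> real"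
    unfolding obs_measure_def using nonneg
    by (auto simp: integrable_density integral_density)
  have score: "deriv \<Xi> \<in> borel_measurable borel" "integrable ?M (deriv \<Xi>)"
    "integrable ?M (\<lambda>x. x * deriv \<Xi> x)"
    "\<And>\<phi>. test_function \<phi> \<Longrightarrow> integrable ?M (\<lambda>x. deriv \<Xi> x * deriv \<phi> x)"
    if \<Xi>: "wasserstein_score p i \<theta> \<Xi>" for \<Xi>
  proof -
    show [measurable]: "deriv \<Xi> \<in> borel_measurable borel"
      using \<Xi> by (intro deriv_borel_measurable) (simp add: wasserstein_score_def)
    have sq: "integrable ?M (\<lambda>x. (deriv \<Xi> x)\<^sup>2)" using \<Xi> by (simp add: wasserstein_score_def)
    have young: "\<bar>a * b\<bar> \<le> a\<^sup>2 + b\<^sup>2" for a b :: real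
      using sum_squares_bound[of "\<bar>a\<bar>" "\<bar>b\<bar>"] abs_ge_zero[of "a * b"]
      unfolding abs_mult power2_abs by linarith
    show I1: "integrable ?M (deriv \<Xi>)"
      by (rule Bochner_Integration.integrable_bound[OF Bochner_Integration.integrable_add[OF p0 sq]])
         (use young[of 1] in \<open>auto simp: meas\<close>)
    show "integrable ?M (\<lambda>x. x * deriv \<Xi> x)"
      by (rule Bochner_Integration.integrable_bound[OF Bochner_Integration.integrable_add[OF p2 sq]])
         (use young in \<open>auto simp: meas\<close>)
    fix \<phi> assume \<phi>: "test_function \<phi>"
    have [measurable]: "deriv \<phi> \<in> borel_measurable borel"
      using test_function_deriv(2)[OF \<phi>] by (rule borel_measurable_continuous_onI)
    obtain B where B: "\<And>x. \<bar>deriv \<phi> x\<bar> \<le> B" using test_function_deriv(3)[OF \<phi>] by blast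
    show "integrable ?M (\<lambda>x. deriv \<Xi> x * deriv \<phi> x)"
    proof (rule Bochner_Integration.integrable_bound)
      show "integrable ?M (\<lambda>x. B * deriv \<Xi> x)" using I1 by simp
      have "\<bar>deriv \<Xi> x\<bar> * \<bar>deriv \<phi> x\<bar> \<le> \<bar>deriv \<Xi> x\<bar> * \<bar>B\<bar>" for x
        using B[of x] by (intro mult_left_mono) auto
      then show "AE x in ?M. norm (deriv \<Xi> x * deriv \<phi> x) \<le> norm (B * deriv \<Xi> x)"
        by (intro AE_I2) (simp add: abs_mult mult.commute)
    qed (auto simp: meas)
  qed
  note [measurable] = score(1)[OF \<Phi>] score(1)[OF \<Psi>]
  define h where "h = (\<lambda>x. p x \<theta> * (deriv \<Phi> x - deriv \<Psi> x))"
  have "AE x in lborel. h x = 0"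
  proof (rule AE_zero_if_weak_derivative_zero)
    show "integrable lborel h"
      unfolding h_def using score(2)[OF \<Phi>] score(2)[OF \<Psi>] by (subst dens(1)[symmetric]) auto
    have "integrable lborel (\<lambda>x. p x \<theta> * (x * deriv \<Phi> x - x * deriv \<Psi> x))"
      using score(3)[OF \<Phi>] score(3)[OF \<Psi>] by (subst dens(1)[symmetric]) auto
    then show "integrable lborel (\<lambda>x. x * h x)" by (simp add: h_def algebra_simps)
    fix \<phi> assume \<phi>: "test_function \<phi>"
    have [measurable]: "deriv \<phi> \<in> borel_measurable borel"
      using test_function_deriv(2)[OF \<phi>] by (rule borel_measurable_continuous_onI)
    have "(LINT x|lborel. p x \<theta> * deriv \<Phi> x * deriv \<phi> x) = (LINT x|lborel. p x \<theta> * deriv \<Psi> x * deriv \<phi> x)"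
      using \<Phi> \<Psi> \<phi> unfolding wasserstein_score_def by (blast intro: DERIV_unique)
    then have "(LINT x|?M. deriv \<Phi> x * deriv \<phi> x) = (LINT x|?M. deriv \<Psi> x * deriv \<phi> x)"
      by (simp add: dens(2) mult.assoc)
    then have "(LINT x|?M. deriv \<Phi> x * deriv \<phi> x - deriv \<Psi> x * deriv \<phi> x) = 0"
      using score(4)[OF \<Phi> \<phi>] score(4)[OF \<Psi> \<phi>] by simp
    then show "(LINT x|lborel. h x * deriv \<phi> x) = 0"
      by (simp add: dens(2) h_def algebra_simps)
  qed
  \<comment> \<open>The factor \<open>p x \<theta>\<close> can be cancelled only where it is
    positive, and \<open>obs_measure\<close> sees nothing else.\<close>
  then have "AE x in lborel. 0 < ennreal (p x \<theta>) \<longrightarrow> deriv \<Phi> x = deriv \<Psi> x"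
    by eventually_elim (auto simp: h_def)
  then show ?thesis unfolding obs_measure_def by (subst AE_density) auto
qed

text \<open>By uniqueness the score derivatives may be replaced by 1 and by the standardized
  observation, whose mixed moments are those of \<open>f\<close>.\<close>

lemma wasserstein_information_location_scale:
  fixes f :: "real \<Rightarrow> real" and \<theta> :: "real^2" and \<Phi> :: "2 \<Rightarrow> real \<Rightarrow> real"
  assumes f [measurable]: "f \<in> borel_measurable borel"
    and nonneg: "\<And>x. 0 \<le> f x"
    and total: "has_bochner_integral lborel f 1"
    and mean: "has_bochner_integral lborel (\<lambda>x. x * f x) 0"
    and var: "has_bochner_integral lborel (\<lambda>x. x\<^sup>2 * f x) 1"
    and s: "\<theta> $ 2 > 0"
    and score: "\<And>i. wasserstein_score (location_scale f) i \<theta> (\<Phi> i)"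
  shows "wasserstein_information (location_scale f) \<Phi> \<theta> = mat 1"
proof -
  let ?M = "obs_measure (location_scale f) \<theta>" and ?m = "\<theta> $ 1" and ?s = "\<theta> $ 2"
  note ex = location_scale_has_expectation[OF f _ nonneg s]
  have one: "has_bochner_integral ?M (\<lambda>x. 1) (1::real)"
    by (rule ex) (use total in auto)
  have lin: "has_bochner_integral ?M (\<lambda>x. (x - ?m) / ?s) 0"
    by (rule ex) (use mean s in \<open>auto simp: mult.commute\<close>)
  have sq: "has_bochner_integral ?M (\<lambda>x. ((x - ?m) / ?s)\<^sup>2) 1"
    by (rule ex) (use var s in \<open>auto simp: mult.commute\<close>)
  \<comment> \<open>The uniqueness lemma asks for the second moment about 0, which is expanded here
    in the standardized observation.\<close>
  have x2: "integrable ?M (\<lambda>x. x\<^sup>2)"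
  proof -
    have "integrable ?M (\<lambda>x. ?s\<^sup>2 * ((x - ?m) / ?s)\<^sup>2 + 2 * ?m * ?s * ((x - ?m) / ?s) + ?m\<^sup>2 * 1)"
      using one lin sq unfolding has_bochner_integral_iff
      by (intro Bochner_Integration.integrable_add integrable_mult_right) auto
    also have "(\<lambda>x. ?s\<^sup>2 * ((x - ?m) / ?s)\<^sup>2 + 2 * ?m * ?s * ((x - ?m) / ?s) + ?m\<^sup>2 * 1) = (\<lambda>x. x\<^sup>2)"
    proof
      fix x
      have e: "?s\<^sup>2 * ((x - ?m) / ?s)\<^sup>2 = (x - ?m)\<^sup>2" "2 * ?m * ?s * ((x - ?m) / ?s) = 2 * ?m * (x - ?m)"
        using s by (auto simp: power_divide)
      show "?s\<^sup>2 * ((x - ?m) / ?s)\<^sup>2 + 2 * ?m * ?s * ((x - ?m) / ?s) + ?m\<^sup>2 * 1 = x\<^sup>2"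
        unfolding e by (simp add: power2_eq_square algebra_simps)
    qed
    finally show ?thesis .
  qed
  define \<psi> :: "2 \<Rightarrow> real \<Rightarrow> real" where "\<psi> i x = (if i = 1 then 1 else (x - ?m) / ?s)" for i x
  note W = wasserstein_score_location_scale[OF f nonneg total mean var s]
  have d1: "deriv (\<lambda>x. x - ?m) = \<psi> 1"
    by (intro ext DERIV_imp_deriv) (auto intro!: derivative_eq_intros simp: \<psi>_def)
  have d2: "deriv (\<lambda>x. (x - ?m)\<^sup>2 / (2 * ?s) - ?s / 2) = \<psi> 2"
    by (intro ext DERIV_imp_deriv) (use s in \<open>auto intro!: derivative_eq_intros simp: \<psi>_def field_simps\<close>)
  note uniq = wasserstein_score_unique[of "location_scale f", OF _ _ _ x2 score]
  have AE: "AE x in ?M. deriv (\<Phi> i) x = \<psi> i x" for i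
  proof -
    have "AE x in ?M. deriv (\<Phi> 1) x = \<psi> 1 x"
      unfolding d1[symmetric]
      by (rule uniq[OF _ _ _ W(1)]) (use one nonneg s in \<open>auto simp: has_bochner_integral_iff location_scale_def\<close>)
    moreover have "AE x in ?M. deriv (\<Phi> 2) x = \<psi> 2 x"
      unfolding d2[symmetric]
      by (rule uniq[OF _ _ _ W(2)]) (use one nonneg s in \<open>auto simp: has_bochner_integral_iff location_scale_def\<close>)
    ultimately show ?thesis using exhaust_2[of i] by auto
  qed
  have meas: "g \<in> borel_measurable ?M" if "g \<in> borel_measurable borel" for g :: "real \<Rightarrow> real"
    using that by (simp add: obs_measure_def)
  have "(LINT x|?M. deriv (\<Phi> i) x * deriv (\<Phi> j) x) = (if i = j then 1 else 0)" for i j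
  proof -
    have [measurable]: "deriv (\<Phi> i) \<in> borel_measurable borel" for i
      using score[of i] by (intro deriv_borel_measurable) (simp add: wasserstein_score_def)
    have [measurable]: "\<psi> i \<in> borel_measurable borel" for i
      unfolding \<psi>_def by simp
    have "(LINT x|?M. deriv (\<Phi> i) x * deriv (\<Phi> j) x) = (LINT x|?M. \<psi> i x * \<psi> j x)"
    proof (rule integral_cong_AE)
      show "AE x in ?M. deriv (\<Phi> i) x * deriv (\<Phi> j) x = \<psi> i x * \<psi> j x"
        using AE[of i] AE[of j] by eventually_elim simp
    qed (auto intro!: meas)
    also have "\<dots> = (if i = j then 1 else 0)"
      using one lin sq exhaust_2[of i] exhaust_2[of j]
      by (auto simp: \<psi>_def has_bochner_integral_iff power2_eq_square)
    finally show ?thesis .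
  qed
  then show ?thesis by (simp add: wasserstein_information_def vec_eq_iff mat_def)
qed

subsection \<open>Asymptotic efficiency\<close>

theorem theorem2:
  fixes f :: "real \<Rightarrow> real" and \<theta> :: "real^2" and \<Phi> :: "2 \<Rightarrow> real \<Rightarrow> real"
  assumes "f \<in> borel_measurable borel"
    and "\<And>x. 0 \<le> f x"
    and "has_bochner_integral lborel f 1"
    and "has_bochner_integral lborel (\<lambda>x. x * f x) 0"
    and "has_bochner_integral lborel (\<lambda>x. x\<^sup>2 * f x) 1"
    and "\<theta> $ 2 > 0"
    and "\<And>i. wasserstein_score (location_scale f) i \<theta> (\<Phi> i)"
  shows "(\<lambda>n. real n *\<^sub>R
            (wasserstein_variance (location_scale f) n (wasserstein_estimator n) \<theta> -
             (1 / real n) *\<^sub>R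
               (transpose (expectation_jacobian (location_scale f) n (wasserstein_estimator n) \<theta>) **
                matrix_inv (wasserstein_information (location_scale f) \<Phi> \<theta>) **
                expectation_jacobian (location_scale f) n (wasserstein_estimator n) \<theta>)))
         \<longlonglongrightarrow> 0"
proof -
  let ?Q = "density lborel (\<lambda>z. ennreal (f z))"
  define c where "c n = (LINT x|Pi\<^sub>M {..<n} (\<lambda>_. ?Q). sample_sd n x)" for n
  \<comment> \<open>With the identity as information matrix and the Jacobian diagonal with entries 1
    and \<open>c n\<close>, the scaled difference is the identity minus the squared
    Jacobian.\<close>
  let ?D = "\<lambda>n. (\<chi> i j. if i = j then (if i = 1 then 0 else 1 - (c n)\<^sup>2) else 0) :: real^2^2"
  note f = assms(1)
  have "c \<longlonglongrightarrow> 1"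
    unfolding c_def
  proof (rule sample_sd_expectation_tendsto)
    show "prob_space ?Q" by (rule prob_space_density_lborel[OF assms(2,3)])
    show "has_bochner_integral ?Q (\<lambda>z. z) 0" "has_bochner_integral ?Q (\<lambda>z. z\<^sup>2) 1"
      using f assms(2,4,5) by (auto intro!: has_bochner_integral_density simp: mult.commute)
  qed simp
  then have lim: "(\<lambda>n. 1 - (c n)\<^sup>2) \<longlonglongrightarrow> 1 - 1\<^sup>2" by (intro tendsto_intros)
  have "?D \<longlonglongrightarrow> 0"
  proof (intro vec_tendstoI)
    show "(\<lambda>n. ?D n $ i $ j) \<longlonglongrightarrow> 0 $ i $ j" for i j
      using lim by (cases "i = j"; cases "i = 1") auto
  qed
  \<comment> \<open>The exact formula for the Wasserstein variance starts at \<open>n = 2\<close>;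
    smaller \<open>n\<close> do not affect the limit.\<close>
  moreover have "\<forall>\<^sub>F n in sequentially. ?D n = real n *\<^sub>R
            (wasserstein_variance (location_scale f) n (wasserstein_estimator n) \<theta> -
             (1 / real n) *\<^sub>R
               (transpose (expectation_jacobian (location_scale f) n (wasserstein_estimator n) \<theta>) **
                matrix_inv (wasserstein_information (location_scale f) \<Phi> \<theta>) **
                expectation_jacobian (location_scale f) n (wasserstein_estimator n) \<theta>))"
    using eventually_ge_at_top[of 2]
  proof eventually_elim
    case (elim n)
    then have n: "n > 0" by simp
    have inv: "matrix_inv (mat 1 :: real^2^2) = mat 1"
      by (simp add: matrix_inv_def)
    have V: "wasserstein_variance (location_scale f) n (wasserstein_estimator n) \<theta> = (1 / real n) *\<^sub>R mat 1"
      by (intro wasserstein_variance_estimator sample_measure_location_scale(1) location_scale_measurable assms elim)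
    show ?case
      unfolding V wasserstein_information_location_scale[OF assms] inv
        expectation_jacobian_location_scale[OF assms(1-4) n assms(6)] c_def[symmetric]
      using n by (simp add: vec_eq_iff forall_2 matrix_matrix_mult_def transpose_def mat_def sum_2 power2_eq_square right_diff_distrib)
  qed
  ultimately show ?thesis by (rule Lim_transform_eventually)
qed

end
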